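(* (Pietsch Domination Theorem) Let $1\leq p<\infty$, let $E$ and $L$ be locally convex spaces, $T:E\to L$ an operator, $U\in\mathcal{N}_0^c(E_\mu)$, and let $K:=\big(U^\circ,\sigma(E',E){\restriction}_{U^\circ}\big)$. Then the following assertions are equivalent: (i) $T$ is $U$-$p$-summing; (ii) for every $V\in\mathcal{N}_0^c(L)$ there exist a regular probability measure $\mu_V$ on the compact space $K$ and a constant $C_V>0$ such that $$q_V\big(T(x)\big)^p\leq C_V^p\cdot\int_K|\langle\chi,x\rangle|^p\,d\mu_V(\chi)\quad\text{for every }x\in E.$$
   Context: All locally convex spaces are Hausdorff, over $\mathbb{F}\in\{\mathbb{R},\mathbb{C}\}$. An operator is a continuous linear map. $\mathcal{N}_0^c(F)$ is the family of all closed absolutely convex neighborhoods of zero in $F$. $E_\mu$ is $E$ with the Mackey topology $\mu(E,E')$, the finest locally convex topology on $E$ with dual $E'$. $U^\circ=\{\chi\in E':|\langle\chi,x\rangle|\le1\ \forall x\in U\}$, and $\sigma(E',E)$ is the weak$^\ast$ topology. $q_V(y)=\inf\{\lambda>0:y\in\lambda V\}$ is the gauge of $V$. For an absolutely convex closed subset $U$ of $E$, an operator $T:E\to L$ is $U$-$p$-summing if for every $V\in\mathcal{N}_0^c(L)$ there is a constant $C_V>0$ such that for every $n\in\omega$ and all $x_0,\dots,x_n\in U$, $$\Big(\sum_{i=0}^nq_V\big(T(x_i)\big)^p\Big)^{1/p}\leq C_V\cdot\sup\Big\{\Big(\sum_{i=0}^n|\langle\chi,x_i\rangle|^p\Big)^{1/p}:\chi\in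 U^\circ\Big\}.$$ *)

theory Defs
  imports "HOL-Analysis.Analysis" "HOL-Probability.Probability_Measure"
begin

text \<open>The scalar fields: the type is \<open>\<real>\<close> or \<open>\<complex>\<close> up to isometric isomorphism of normed fields.\<close>

class real_or_complex = real_normed_field +
  assumes real_or_complex:
    "(\<forall>z. \<exists>a. z = a *\<^sub>R 1) \<or>
     (\<exists>j. j * j = - 1 \<and>
          (\<forall>z. \<exists>a b. z = a *\<^sub>R 1 + b *\<^sub>R j \<and> norm z = sqrt (a\<^sup>2 + b\<^sup>2)))"

instance real :: real_or_complex
proof
  have "\<forall>z::real. \<exists>a. z = a *\<^sub>R 1" by auto
  then show "(\<forall>z::real. \<exists>a. z = a *\<^sub>R 1) \<or>
     (\<exists>j::real. j * j = - 1 \<and>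
          (\<forall>z. \<exists>a b. z = a *\<^sub>R 1 + b *\<^sub>R j \<and> norm z = sqrt (a\<^sup>2 + b\<^sup>2)))" ..
qed

instance complex :: real_or_complex
proof
  have "\<exists>a b. z = a *\<^sub>R 1 + b *\<^sub>R \<i> \<and> norm z = sqrt (a\<^sup>2 + b\<^sup>2)" for z :: complex
    by (intro exI[of _ "Re z"] exI[of _ "Im z"]) (auto simp: complex_eq_iff cmod_def)
  then have "\<exists>j::complex. j * j = - 1 \<and>
          (\<forall>z. \<exists>a b. z = a *\<^sub>R 1 + b *\<^sub>R j \<and> norm z = sqrt (a\<^sup>2 + b\<^sup>2))"
    by (intro exI[of _ "\<i>"]) auto
  then show "(\<forall>z::complex. \<exists>a. z = a *\<^sub>R 1) \<or>
     (\<exists>j::complex. j * j = - 1 \<and>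
          (\<forall>z. \<exists>a b. z = a *\<^sub>R 1 + b *\<^sub>R j \<and> norm z = sqrt (a\<^sup>2 + b\<^sup>2)))" ..
qed

text \<open>The underlying vector space is a whole type with an explicit scalar multiplication, while
  the topology is an explicit value, so that one space can carry several topologies.\<close>

definition zero_nhd :: "'e::ab_group_add topology \<Rightarrow> 'e set \<Rightarrow> bool" where
  "zero_nhd X V \<longleftrightarrow> (\<exists>W. openin X W \<and> 0 \<in> W \<and> W \<subseteq> V)"

definition convex_in :: "('k::real_or_complex \<Rightarrow> 'e::ab_group_add \<Rightarrow> 'e) \<Rightarrow> 'e set \<Rightarrow> bool" where
  "convex_in smul V \<longleftrightarrow>
     (\<forall>x\<in>V. \<forall>y\<in>V. \<forall>a b::real. 0 \<le> a \<longrightarrow> 0 \<le> b \<longrightarrow> a + b = 1 \<longrightarrow>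
        smul (of_real a) x + smul (of_real b) y \<in> V)"

definition absolutely_convex ::
    "('k::real_or_complex \<Rightarrow> 'e::ab_group_add \<Rightarrow> 'e) \<Rightarrow> 'e set \<Rightarrow> bool" where
  "absolutely_convex smul V \<longleftrightarrow>
     (\<forall>x\<in>V. \<forall>y\<in>V. \<forall>a b. norm a + norm b \<le> 1 \<longrightarrow> smul a x + smul b y \<in> V)"

locale locally_convex_space = vector_space smul
  for smul :: "'k::real_or_complex \<Rightarrow> 'e::ab_group_add \<Rightarrow> 'e" +
  fixes X :: "'e topology"
  assumes topspace_UNIV: "topspace X = UNIV"
    and Hausdorff: "Hausdorff_space X"
    and continuous_add: "continuous_map (prod_topology X X) X (\<lambda>(x, y). x + y)"
    and continuous_scale: "continuous_map (prod_topology euclidean X) X (\<lambda>(c, x). smul c x)"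
    and convex_base: "zero_nhd X W \<Longrightarrow> \<exists>V. zero_nhd X V \<and> convex_in smul V \<and> V \<subseteq> W"

definition closed_abs_convex_nhds ::
    "('k::real_or_complex \<Rightarrow> 'e::ab_group_add \<Rightarrow> 'e) \<Rightarrow> 'e topology \<Rightarrow> 'e set set" where
  "closed_abs_convex_nhds smul X =
     {V. closedin X V \<and> absolutely_convex smul V \<and> zero_nhd X V}"

definition operator ::
    "('k::real_or_complex \<Rightarrow> 'e::ab_group_add \<Rightarrow> 'e) \<Rightarrow> 'e topology \<Rightarrow>
     ('k \<Rightarrow> 'l::ab_group_add \<Rightarrow> 'l) \<Rightarrow> 'l topology \<Rightarrow> ('e \<Rightarrow> 'l) \<Rightarrow> bool" where
  "operator smulE E smulL L T \<longleftrightarrow> Vector_Spaces.linear smulE smulL T \<and> continuous_map E L T"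

definition dual_space ::
    "('k::real_or_complex \<Rightarrow> 'e::ab_group_add \<Rightarrow> 'e) \<Rightarrow> 'e topology \<Rightarrow> ('e \<Rightarrow> 'k) set" where
  "dual_space smul X = {\<phi>. operator smul X (*) euclidean \<phi>}"

text \<open>\<open>M\<close> is the Mackey topology of \<open>(E, X)\<close>.  Such an \<open>M\<close> is unique, and it exists by the
  Mackey--Arens theorem.\<close>

definition mackey_topology ::
    "('k::real_or_complex \<Rightarrow> 'e::ab_group_add \<Rightarrow> 'e) \<Rightarrow> 'e topology \<Rightarrow> 'e topology \<Rightarrow> bool" where
  "mackey_topology smul X M \<longleftrightarrow>
     locally_convex_space smul M \<and> dual_space smul M = dual_space smul X \<and>
     (\<forall>N. locally_convex_space smul N \<and> dual_space smul N = dual_space smul X \<longrightarrow>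
        (\<forall>S. openin N S \<longrightarrow> openin M S))"

definition polar_set ::
    "('k::real_or_complex \<Rightarrow> 'e::ab_group_add \<Rightarrow> 'e) \<Rightarrow> 'e topology \<Rightarrow> 'e set \<Rightarrow> ('e \<Rightarrow> 'k) set" where
  "polar_set smul X U = {\<phi> \<in> dual_space smul X. \<forall>x\<in>U. norm (\<phi> x) \<le> 1}"

text \<open>The topology of pointwise convergence on the dual.\<close>

definition weak_star_topology ::
    "('k::real_or_complex \<Rightarrow> 'e::ab_group_add \<Rightarrow> 'e) \<Rightarrow> 'e topology \<Rightarrow> ('e \<Rightarrow> 'k) topology" where
  "weak_star_topology smul X =
     subtopology (product_topology (\<lambda>_. euclidean) UNIV) (dual_space smul X)"

definition gauge_fun ::
    "('k::real_or_complex \<Rightarrow> 'l::ab_group_add \<Rightarrow> 'l) \<Rightarrow> 'l set \<Rightarrow> 'l \<Rightarrow> real" where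
  "gauge_fun smul V y = Inf {r. r > 0 \<and> y \<in> smul (of_real r) ` V}"

definition U_p_summing ::
    "('k::real_or_complex \<Rightarrow> 'e::ab_group_add \<Rightarrow> 'e) \<Rightarrow> 'e topology \<Rightarrow>
     ('k \<Rightarrow> 'l::ab_group_add \<Rightarrow> 'l) \<Rightarrow> 'l topology \<Rightarrow>
     'e set \<Rightarrow> real \<Rightarrow> ('e \<Rightarrow> 'l) \<Rightarrow> bool" where
  "U_p_summing smulE E smulL L U p T \<longleftrightarrow>
     (\<forall>V \<in> closed_abs_convex_nhds smulL L. \<exists>C>0. \<forall>n. \<forall>x :: nat \<Rightarrow> 'e. (\<forall>i\<le>n. x i \<in> U) \<longrightarrow>
        (\<Sum>i\<le>n. gauge_fun smulL V (T (x i)) powr p) powr (1 / p)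
          \<le> C * (SUP \<phi> \<in> polar_set smulE E U. (\<Sum>i\<le>n. norm (\<phi> (x i)) powr p) powr (1 / p)))"

definition regular_probability_measure :: "'a topology \<Rightarrow> 'a measure \<Rightarrow> bool" where
  "regular_probability_measure K \<mu> \<longleftrightarrow>
     prob_space \<mu> \<and> space \<mu> = topspace K \<and>
     sets \<mu> = sigma_sets (topspace K) {S. openin K S} \<and>
     (\<forall>A \<in> sets \<mu>.
        emeasure \<mu> A = (SUP C \<in> {C. compactin K C \<and> C \<subseteq> A}. emeasure \<mu> C) \<and>
        emeasure \<mu> A = (INF G \<in> {G. openin K G \<and> A \<subseteq> G}. emeasure \<mu> G))"

end

theory Submission
  imports Defs "HOL-Probability.Discrete_Topology"
begin

text \<open>
  The easy direction integrates: summing the domination inequality over finitely many points of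
  \<open>U\<close> and bounding the integrand by its supremum over the polar gives the summing inequality with
  the same constant.

  For the converse, fix a neighbourhood \<open>V\<close> with gauge \<open>q\<close> and a constant \<open>C\<close>. Each finite family
  \<open>xs\<close> of points gives a continuous function
  \<open>\<phi> \<mapsto> (\<Sum>x\<leftarrow>xs. q (T x) powr p - C powr p * norm (\<phi> x) powr p)\<close> on the polar \<open>K\<close> of
  \<open>U\<close>. These functions form a convex cone, and the summing inequality says that each of them
  takes values below every positive number. A measure is needed whose integral is nonpositive on the
  whole cone; applied to one-element families this is the domination inequality.

  Such a measure comes from the Hahn--Banach theorem and a Riesz representation theorem, both
  proved here. The Hahn--Banach theorem (\<open>linear_below_sublinear\<close>) follows from Zorn's lemma since
  minimal sublinear functionals are linear. It yields a positive normalized functional \<open>\<Lambda>\<close>, defined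
  on all bounded functions on \<open>K\<close>, that is nonpositive on the cone
  (\<open>positive_functional_nonpositive_on_cone\<close>). Admitting all
  bounded functions makes \<open>\<Lambda>\<close> a finitely additive probability on indicators. Regularization
  turns it into a regular Borel measure which is at least
  \<open>\<Lambda>\<close> on closed sets (\<open>regular_measure_above_on_closed_sets\<close>), and slicing a continuous function
  into its superlevel sets shows that its integral equals \<open>\<Lambda>\<close>
  (\<open>Riesz_representation_compact_Hausdorff\<close>).

  The topology of \<open>E\<close> enters through the compactness of \<open>K\<close> (\<open>Alaoglu_polar\<close>): \<open>U\<close> is a
  neighbourhood for the Mackey topology, which has the same continuous functionals as the given one,
  so every linear functional bounded by \<open>1\<close> on \<open>U\<close> belongs to the polar. Since \<open>U\<close> is also absorbing,
  the inequality for points of \<open>U\<close> extends to all points by homogeneity.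
\<close>

section \<open>Linear functionals below sublinear functionals\<close>

definition sublinear :: "('v::real_vector \<Rightarrow> real) \<Rightarrow> bool" where
  "sublinear s \<longleftrightarrow> (\<forall>x y. s (x + y) \<le> s x + s y) \<and> (\<forall>c\<ge>0. \<forall>x. s (c *\<^sub>R x) = c * s x)"

lemma sublinearD:
  assumes "sublinear s"
  shows sublinear_add: "s (x + y) \<le> s x + s y"
    and sublinear_scale: "c \<ge> 0 \<Longrightarrow> s (c *\<^sub>R x) = c * s x"
    and sublinear_lower: "- s (- x) \<le> s x"
proof -
  show add: "s (x + y) \<le> s x + s y" and scale: "c \<ge> 0 \<Longrightarrow> s (c *\<^sub>R x) = c * s x" for c x y
    using assms by (auto simp: sublinear_def)
  show "- s (- x) \<le> s x"
    using add[of x "- x"] scale[of 0 0] by simp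
qed

text \<open>Homogeneity follows from the inequality for \<open>c > 0\<close>, because the inequality for
  \<open>1 / c\<close> is its converse. In the infimum constructions below the inequality is the half that
  is easy to read off.\<close>

lemma sublinearI:
  assumes add: "\<And>x y. s (x + y) \<le> s x + s y"
    and scale: "\<And>c x. c > 0 \<Longrightarrow> s (c *\<^sub>R x) \<le> c * s x"
  shows "sublinear s"
proof -
  have "s (0::'a) = 0"
    using add[of 0 0] scale[of "1/2" 0] by simp
  moreover have "s (c *\<^sub>R x) = c * s x" if "c > 0" for c x
  proof (rule antisym)
    have "s x \<le> (1 / c) * s (c *\<^sub>R x)"
      using scale[of "1 / c" "c *\<^sub>R x"] that by simp
    then show "c * s x \<le> s (c *\<^sub>R x)"
      using that by (simp add: field_simps)
  qed (use scale that in blast)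
  ultimately have "s (c *\<^sub>R x) = c * s x" if "c \<ge> 0" for c x
    using that by (cases "c = 0") auto
  then show ?thesis
    using add by (auto simp: sublinear_def)
qed

text \<open>A sublinear functional that fails to be additive at \<open>h\<close> can be lowered: the largest sublinear
  functional below \<open>s\<close> whose slope in the direction \<open>- h\<close> is at most \<open>- s h\<close> is
  \<open>t x = (INF r\<ge>0. s (x + r h) - r * s h)\<close>. Minimality forces \<open>t = s\<close>, and the term
  \<open>r = 1\<close> of the infimum is then the missing superadditivity.\<close>

lemma minimal_sublinear_imp_linear:
  assumes s: "sublinear s"
    and minimal: "\<And>t. sublinear t \<Longrightarrow> t \<le> s \<Longrightarrow> t = s"
  shows "linear s"
proof -
  note scale = sublinear_scale[OF s] and add' = sublinear_add[OF s]
  have superadd: "s g + s h \<le> s (g + h)" for g h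
  proof -
    define t where "t x = (INF r\<in>{0..}. s (x + r *\<^sub>R h) - r * s h)" for x
    have lower: "- s (- x) \<le> s (x + r *\<^sub>R h) - r * s h" if "r \<ge> 0" for x r
      using add'[of "x + r *\<^sub>R h" "- x"] scale[of r h] that by simp
    have bdd: "bdd_below ((\<lambda>r. s (x + r *\<^sub>R h) - r * s h) ` {0..})" for x
      using lower by (intro bdd_belowI2) auto
    have t_le: "t x \<le> s (x + r *\<^sub>R h) - r * s h" if "r \<ge> 0" for x r
      unfolding t_def using that by (intro cINF_lower bdd) auto
    have le_t: "a \<le> t x" if "\<And>r. r \<ge> 0 \<Longrightarrow> a \<le> s (x + r *\<^sub>R h) - r * s h" for a x
      unfolding t_def using that by (intro cINF_greatest) auto
    have "sublinear t"
    proof (rule sublinearI)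
      fix x y
      have *: "t (x + y) \<le> (s (x + r *\<^sub>R h) - r * s h) + (s (y + q *\<^sub>R h) - q * s h)"
        if "r \<ge> 0" "q \<ge> 0" for r q
        using t_le[of "r + q" "x + y"] add'[of "x + r *\<^sub>R h" "y + q *\<^sub>R h"] that
        by (simp add: algebra_simps)
      have "t (x + y) - (s (y + q *\<^sub>R h) - q * s h) \<le> t x" if "q \<ge> 0" for q
        using *[OF _ that] by (intro le_t) (simp add: diff_le_eq)
      then have "t (x + y) - t x \<le> t y"
        by (intro le_t) (simp add: algebra_simps)
      then show "t (x + y) \<le> t x + t y" by simp
    next
      fix c :: real and x assume c: "c > 0"
      have "t (c *\<^sub>R x) / c \<le> t x"
      proof (rule le_t)
        fix r :: real assume r: "r \<ge> 0"
        have "t (c *\<^sub>R x) \<le> s (c *\<^sub>R (x + r *\<^sub>R h)) - (c * r) * s h"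
          using t_le[of "c * r" "c *\<^sub>R x"] c r by (simp add: algebra_simps)
        also have "\<dots> = c * (s (x + r *\<^sub>R h) - r * s h)"
          using scale[of c "x + r *\<^sub>R h"] c by (simp add: algebra_simps)
        finally show "t (c *\<^sub>R x) / c \<le> s (x + r *\<^sub>R h) - r * s h"
          using c by (simp add: field_simps)
      qed
      then show "t (c *\<^sub>R x) \<le> c * t x"
        using c by (simp add: field_simps)
    qed
    moreover have "t \<le> s"
      using t_le[of 0] by (auto simp: le_fun_def)
    ultimately have "t = s" by (rule minimal)
    then show ?thesis
      using t_le[of 1 g] by simp
  qed
  have add: "s (x + y) = s x + s y" for x y
    using superadd add' by (intro antisym)
  have "s (c *\<^sub>R x) = c * s x" for c x
  proof (cases "c \<ge> 0")
    case False
    have "s (c *\<^sub>R x) + s ((- c) *\<^sub>R x) = 0"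
      using add[of "c *\<^sub>R x" "(- c) *\<^sub>R x"] scale[of 0 0] by simp
    then show ?thesis
      using False scale[of "- c" x] by simp
  qed (use scale in blast)
  with add show ?thesis
    by (intro linearI) auto
qed

text \<open>The chain condition yields subadditivity: given two members of the chain, the smaller one
  bounds the infimum at \<open>x + y\<close>. The common bound \<open>q\<close> keeps the infimum finite, since
  \<open>- q (- x) \<le> - s (- x) \<le> s x\<close>.\<close>

lemma sublinear_INF_chain:
  assumes C: "C \<noteq> {}"
    and sub: "\<And>s. s \<in> C \<Longrightarrow> sublinear s"
    and chain: "\<And>s t. s \<in> C \<Longrightarrow> t \<in> C \<Longrightarrow> s \<le> t \<or> t \<le> s"
    and le: "\<And>s. s \<in> C \<Longrightarrow> s \<le> q"
  defines "u \<equiv> \<lambda>x. INF s\<in>C. s x"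
  shows "sublinear u" and "\<And>s. s \<in> C \<Longrightarrow> u \<le> s"
proof -
  have bdd: "bdd_below ((\<lambda>s. s x) ` C)" for x
  proof (rule bdd_belowI2)
    fix s assume s: "s \<in> C"
    show "- q (- x) \<le> s x"
      using sublinear_lower[OF sub[OF s], of x] le_funD[OF le[OF s], of "- x"] by linarith
  qed
  have u_le: "u x \<le> s x" if "s \<in> C" for s x
    unfolding u_def using that by (intro cINF_lower bdd)
  then show "\<And>s. s \<in> C \<Longrightarrow> u \<le> s"
    by (auto simp: le_fun_def)
  have le_u: "a \<le> u x" if "\<And>s. s \<in> C \<Longrightarrow> a \<le> s x" for a x
    unfolding u_def using that C by (intro cINF_greatest) auto
  show "sublinear u"
  proof (rule sublinearI)
    fix x y
    have *: "u (x + y) \<le> s x + t y" if "s \<in> C" "t \<in> C" for s t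
    proof (cases "s \<le> t")
      case True
      then show ?thesis
        using u_le[OF that(1), of "x + y"] sublinear_add[OF sub[OF that(1)], of x y] le_funD[OF True, of y]
        by linarith
    next
      case False
      then have "t \<le> s" using chain that by blast
      then show ?thesis
        using u_le[OF that(2), of "x + y"] sublinear_add[OF sub[OF that(2)], of x y] le_funD[of t s x]
        by linarith
    qed
    have "u (x + y) - t y \<le> u x" if "t \<in> C" for t
      using *[OF _ that] by (intro le_u) (simp add: diff_le_eq)
    then have "u (x + y) - u x \<le> u y"
      by (intro le_u) (simp add: algebra_simps)
    then show "u (x + y) \<le> u x + u y" by simp
  next
    fix c :: real and x assume c: "c > 0"
    have "u (c *\<^sub>R x) / c \<le> u x"
    proof (rule le_u)
      fix s assume s: "s \<in> C"
      show "u (c *\<^sub>R x) / c \<le> s x"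
        using u_le[OF s, of "c *\<^sub>R x"] sublinear_scale[OF sub[OF s], of c x] c
        by (simp add: field_simps)
    qed
    then show "u (c *\<^sub>R x) \<le> c * u x"
      using c by (simp add: field_simps)
  qed
qed

text \<open>This is the analytic form of the Hahn--Banach theorem: by Zorn's lemma there is a minimal
  sublinear functional below \<open>q\<close>, and minimal ones are linear.\<close>

lemma linear_below_sublinear:
  fixes q :: "'v::real_vector \<Rightarrow> real"
  assumes q: "sublinear q"
  obtains l where "linear l" and "l \<le> q"
proof -
  define A where "A = {s. sublinear s \<and> s \<le> q}"
  have "\<exists>l\<in>A. \<forall>t\<in>A. t \<le> l \<longrightarrow> t = l"
  proof (rule predicate_Zorn)
    show "partial_order_on A (relation_of (\<lambda>s t. t \<le> s) A)"
      by (rule partial_order_on_relation_ofI) auto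
  next
    fix C assume C: "C \<in> Chains (relation_of (\<lambda>s t. t \<le> s) A)"
    then have CA: "C \<subseteq> A" and chain: "\<And>s t. s \<in> C \<Longrightarrow> t \<in> C \<Longrightarrow> s \<le> t \<or> t \<le> s"
      by (auto simp: Chains_def relation_of_def)
    show "\<exists>u\<in>A. \<forall>s\<in>C. u \<le> s"
    proof (cases "C = {}")
      case True
      then show ?thesis using q by (auto simp: A_def)
    next
      case False
      define u where "u = (\<lambda>x. INF s\<in>C. s x)"
      have sub: "sublinear s" "s \<le> q" if "s \<in> C" for s
        using that CA by (auto simp: A_def)
      have "sublinear u" and u: "\<And>s. s \<in> C \<Longrightarrow> u \<le> s"
        unfolding u_def using sublinear_INF_chain[OF False sub(1) chain sub(2)] by blast+
      moreover have "u \<le> q"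
        using False u CA by (force simp: A_def intro: order_trans)
      ultimately show ?thesis by (auto simp: A_def)
    qed
  qed
  then obtain l where l: "l \<in> A" and "\<And>t. t \<in> A \<Longrightarrow> t \<le> l \<Longrightarrow> t = l"
    by blast
  then have "linear l"
    by (intro minimal_sublinear_imp_linear) (auto simp: A_def intro: order_trans)
  with l that show ?thesis by (auto simp: A_def)
qed

section \<open>Positive functionals and cones of bounded functions\<close>

text \<open>The Hahn--Banach theorem is applied to
  \<open>q g = (INF f\<in>F. SUP x\<in>P. g x - f x)\<close> on the space of all bounded functions. A linear
  functional below \<open>q\<close> is at most the supremum (take \<open>f = 0\<close>) and at most \<open>0\<close> on \<open>F\<close>
  (take \<open>f = g\<close>). The last assumption, that no member of the cone is bounded away from \<open>0\<close> from
  below on \<open>P\<close>, makes \<open>q\<close> finite. All bounded functions are admitted, not only continuous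
  ones, so that the functional can be evaluated on indicators.\<close>

lemma positive_functional_nonpositive_on_cone:
  fixes P :: "'c set" and F :: "('c \<Rightarrow> real) set"
  assumes bounded: "\<And>f. f \<in> F \<Longrightarrow> bounded (f ` P)"
    and zero: "(\<lambda>_. 0) \<in> F"
    and add: "\<And>f g. f \<in> F \<Longrightarrow> g \<in> F \<Longrightarrow> (\<lambda>x. f x + g x) \<in> F"
    and scale: "\<And>c f. c > 0 \<Longrightarrow> f \<in> F \<Longrightarrow> (\<lambda>x. c * f x) \<in> F"
    and small: "\<And>f \<epsilon>. f \<in> F \<Longrightarrow> \<epsilon> > 0 \<Longrightarrow> \<exists>x\<in>P. f x < \<epsilon>"
  obtains \<Lambda> :: "('c \<Rightarrow> real) \<Rightarrow> real" where
    "\<And>f g. bounded (f ` P) \<Longrightarrow> bounded (g ` P) \<Longrightarrow> \<Lambda> (\<lambda>x. f x + g x) = \<Lambda> f + \<Lambda> g"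
    "\<And>c f. bounded (f ` P) \<Longrightarrow> \<Lambda> (\<lambda>x. c * f x) = c * \<Lambda> f"
    "\<And>f b. bounded (f ` P) \<Longrightarrow> (\<And>x. x \<in> P \<Longrightarrow> f x \<le> b) \<Longrightarrow> \<Lambda> f \<le> b"
    "\<And>f. f \<in> F \<Longrightarrow> \<Lambda> f \<le> 0"
proof -
  \<comment> \<open>the upper bounds of all the functions \<open>g - f\<close>, so that \<open>q g\<close> is a single infimum; bounded
    functions become a vector space as continuous functions on a discrete space\<close>
  define B where "B g = {b. \<exists>f\<in>F. \<forall>x\<in>P. g (discrete x) - f x \<le> b}"
    for g :: "'c discrete \<Rightarrow>\<^sub>C real"
  define q where "q g = Inf (B g)" for g
  have BI: "b \<in> B g" if "f \<in> F" "\<And>x. x \<in> P \<Longrightarrow> g (discrete x) - f x \<le> b" for b f and g :: "'c discrete \<Rightarrow>\<^sub>C real"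
    using that by (auto simp: B_def)
  have bdd: "bdd_below (B g)" for g
  proof -
    obtain M where M: "\<And>x. \<bar>apply_bcontfun g x\<bar> \<le> M"
      using bounded_apply_bcontfun[of g] by (auto simp: bounded_iff)
    have "- M - 1 \<le> b" if "b \<in> B g" for b
    proof -
      from that obtain f where f: "f \<in> F" "\<And>x. x \<in> P \<Longrightarrow> g (discrete x) - f x \<le> b"
        by (auto simp: B_def)
      obtain x where "x \<in> P" "f x < 1" using small[OF f(1), of 1] by auto
      then show ?thesis
        using f(2)[of x] M[of "discrete x"] by linarith
    qed
    then show ?thesis by (rule bdd_belowI)
  qed
  have nonempty: "B g \<noteq> {}" for g
  proof -
    obtain M where M: "\<And>x. \<bar>apply_bcontfun g x\<bar> \<le> M"
      using bounded_apply_bcontfun[of g] by (auto simp: bounded_iff)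
    have "M \<in> B g"
    proof (rule BI[OF zero])
      show "g (discrete x) - 0 \<le> M" for x
        using M[of "discrete x"] by linarith
    qed
    then show ?thesis by auto
  qed
  have q_le: "q g \<le> b" if "b \<in> B g" for b g
    unfolding q_def using that by (intro cInf_lower bdd)
  have le_q: "a \<le> q g" if "\<And>b. b \<in> B g \<Longrightarrow> a \<le> b" for a g
    unfolding q_def using that by (intro cInf_greatest nonempty)
  have "sublinear q"
  proof (rule sublinearI)
    fix g h
    have *: "q (g + h) \<le> b + c" if "b \<in> B g" "c \<in> B h" for b c
    proof -
      from that obtain f1 f2 where f: "f1 \<in> F" "f2 \<in> F"
        and b: "\<And>x. x \<in> P \<Longrightarrow> g (discrete x) - f1 x \<le> b"
        and c: "\<And>x. x \<in> P \<Longrightarrow> h (discrete x) - f2 x \<le> c"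
        unfolding B_def by blast
      have "b + c \<in> B (g + h)"
      proof (rule BI[OF add[OF f]])
        fix x assume "x \<in> P"
        then show "(g + h) (discrete x) - (f1 x + f2 x) \<le> b + c"
          using b[of x] c[of x] by (simp add: plus_bcontfun.rep_eq)
      qed
      then show ?thesis by (rule q_le)
    qed
    have "q (g + h) - c \<le> q g" if "c \<in> B h" for c
      using *[OF _ that] by (intro le_q) (simp add: diff_le_eq)
    then have "q (g + h) - q g \<le> q h"
      by (intro le_q) (simp add: algebra_simps)
    then show "q (g + h) \<le> q g + q h" by simp
  next
    fix c :: real and g assume c: "c > 0"
    have "q (c *\<^sub>R g) / c \<le> q g"
    proof (rule le_q)
      fix b assume "b \<in> B g"
      then obtain f where f: "f \<in> F" "\<And>x. x \<in> P \<Longrightarrow> g (discrete x) - f x \<le> b"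
        by (auto simp: B_def)
      have "c * b \<in> B (c *\<^sub>R g)"
        using f c by (intro BI[OF scale[of c f]])
          (auto simp: scaleR_bcontfun.rep_eq simp flip: right_diff_distrib)
      then show "q (c *\<^sub>R g) / c \<le> b"
        using q_le c by (simp add: field_simps)
    qed
    then show "q (c *\<^sub>R g) \<le> c * q g"
      using c by (simp add: field_simps)
  qed
  then obtain l where l: "linear l" "\<And>g. l g \<le> q g"
    using linear_below_sublinear by (metis le_funD)
  \<comment> \<open>functions on \<open>P\<close> are extended by \<open>0\<close>, since they need not be bounded outside \<open>P\<close>\<close>
  define lift where "lift f = Bcontfun (\<lambda>d. if of_discrete d \<in> P then f (of_discrete d) else 0)"
    for f :: "'c \<Rightarrow> real"
  have lift: "apply_bcontfun (lift f) d = (if of_discrete d \<in> P then f (of_discrete d) else 0)"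
    if "bounded (f ` P)" for f d
  proof -
    have "bounded (insert 0 (f ` P))" using that by simp
    then have "bounded (range (\<lambda>d. if of_discrete d \<in> P then f (of_discrete d) else 0))"
      by (rule bounded_subset) auto
    then have "(\<lambda>d. if of_discrete d \<in> P then f (of_discrete d) else 0) \<in> bcontfun"
      by (auto simp: bcontfun_def continuous_on_open_invariant open_discrete)
    then show ?thesis
      by (simp add: lift_def Bcontfun_inverse)
  qed
  have bdd_add: "bounded ((\<lambda>x. f x + g x) ` P)" if "bounded (f ` P)" "bounded (g ` P)" for f g :: "'c \<Rightarrow> real"
    using that by (rule bounded_plus_comp)
  have bdd_scale: "bounded ((\<lambda>x. c * f x) ` P)" if "bounded (f ` P)" for c and f :: "'c \<Rightarrow> real"
    using bounded_scaling[OF that, of c] by (simp add: image_image)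
  show ?thesis
  proof (rule that[of "\<lambda>f. l (lift f)"])
    fix f g :: "'c \<Rightarrow> real" assume fg: "bounded (f ` P)" "bounded (g ` P)"
    have "lift (\<lambda>x. f x + g x) = lift f + lift g"
      using fg bdd_add[OF fg] by (intro bcontfun_eqI) (simp add: lift plus_bcontfun.rep_eq)
    then show "l (lift (\<lambda>x. f x + g x)) = l (lift f) + l (lift g)"
      using l(1) by (simp add: linear_add)
  next
    fix c and f :: "'c \<Rightarrow> real" assume f: "bounded (f ` P)"
    have "lift (\<lambda>x. c * f x) = c *\<^sub>R lift f"
      using f bdd_scale[OF f, of c] by (intro bcontfun_eqI) (simp add: lift scaleR_bcontfun.rep_eq)
    then show "l (lift (\<lambda>x. c * f x)) = c * l (lift f)"
      using l(1) by (simp add: linear_cmul)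
  next
    fix f :: "'c \<Rightarrow> real" and b assume f: "bounded (f ` P)" "\<And>x. x \<in> P \<Longrightarrow> f x \<le> b"
    have "b \<in> B (lift f)"
      using f by (intro BI[OF zero]) (simp add: lift discrete_inverse)
    then show "l (lift f) \<le> b"
      using l(2) q_le by (meson order_trans)
  next
    fix f :: "'c \<Rightarrow> real" assume f: "f \<in> F"
    have "0 \<in> B (lift f)"
      using f bounded[OF f] by (intro BI[OF f]) (simp add: lift discrete_inverse)
    then show "l (lift f) \<le> 0"
      using l(2) q_le by (meson order_trans)
  qed
qed

section \<open>From finitely additive probabilities to regular measures\<close>

text \<open>A finitely additive probability on all subsets of a compact Hausdorff space is turned into a
  regular Borel measure by approximating open sets from inside by closed sets, and then arbitrary
  sets from outside by open sets. Compactness upgrades finite to countable additivity. Mass may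
  move, but only onto closed sets and away from open ones.\<close>

locale finitely_additive_probability =
  fixes K :: "'a topology" and m :: "'a set \<Rightarrow> ennreal"
  assumes compact: "compact_space K"
    and Hausdorff: "Hausdorff_space K"
    and empty: "m {} = 0"
    and additive: "\<And>A B. A \<subseteq> topspace K \<Longrightarrow> B \<subseteq> topspace K \<Longrightarrow> A \<inter> B = {} \<Longrightarrow> m (A \<union> B) = m A + m B"
    and total: "m (topspace K) = 1"
begin

lemma mono:
  assumes "A \<subseteq> B" "B \<subseteq> topspace K"
  shows "m A \<le> m B"
proof -
  have "m B = m (A \<union> (B - A))" using assms by (simp add: Un_absorb1)
  also have "\<dots> = m A + m (B - A)" using assms by (intro additive) auto
  finally show ?thesis by simp
qed

lemma subadditive:
  assumes "A \<subseteq> topspace K" "B \<subseteq> topspace K"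
  shows "m (A \<union> B) \<le> m A + m B"
proof -
  have "m (A \<union> B) = m (A \<union> (B - A))" by simp
  also have "\<dots> = m A + m (B - A)" using assms by (intro additive) auto
  also have "\<dots> \<le> m A + m B" using assms by (intro add_left_mono mono) auto
  finally show ?thesis .
qed

definition inner_content :: "'a set \<Rightarrow> ennreal" where
  "inner_content G = (SUP C\<in>{C. closedin K C \<and> C \<subseteq> G}. m C)"

definition outer_content :: "'a set \<Rightarrow> ennreal" where
  "outer_content A = (INF G\<in>{G. openin K G \<and> A \<subseteq> G}. inner_content G)"

lemma inner_upper: "closedin K C \<Longrightarrow> C \<subseteq> G \<Longrightarrow> m C \<le> inner_content G"
  by (auto simp: inner_content_def intro!: SUP_upper)

lemma inner_least: "(\<And>C. closedin K C \<Longrightarrow> C \<subseteq> G \<Longrightarrow> m C \<le> b) \<Longrightarrow> inner_content G \<le> b"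
  by (auto simp: inner_content_def intro!: SUP_least)

lemma inner_mono: "G \<subseteq> H \<Longrightarrow> inner_content G \<le> inner_content H"
  by (rule inner_least) (auto intro: inner_upper)

lemma outer_lower: "openin K G \<Longrightarrow> A \<subseteq> G \<Longrightarrow> outer_content A \<le> inner_content G"
  by (auto simp: outer_content_def intro!: INF_lower)

lemma outer_greatest: "(\<And>G. openin K G \<Longrightarrow> A \<subseteq> G \<Longrightarrow> b \<le> inner_content G) \<Longrightarrow> b \<le> outer_content A"
  by (auto simp: outer_content_def intro!: INF_greatest)

lemma outer_mono: "A \<subseteq> B \<Longrightarrow> outer_content A \<le> outer_content B"
  by (rule outer_greatest) (auto intro: outer_lower)

lemma outer_open: "openin K G \<Longrightarrow> outer_content G = inner_content G"
  by (intro antisym outer_greatest) (auto intro: outer_lower inner_mono)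

lemma closed_le_outer: "closedin K C \<Longrightarrow> m C \<le> outer_content C"
  by (rule outer_greatest) (auto intro: inner_upper)

text \<open>Normality cuts a closed subset of \<open>G \<union> H\<close> into a closed part inside \<open>G\<close> and a closed
  part inside \<open>H\<close>.\<close>

lemma inner_Un:
  assumes G: "openin K G" and H: "openin K H"
  shows "inner_content (G \<union> H) \<le> inner_content G + inner_content H"
proof (rule inner_least)
  fix C assume C: "closedin K C" "C \<subseteq> G \<union> H"
  have "normal_space K"
    using compact Hausdorff compact_Hausdorff_or_regular_imp_normal_space by blast
  moreover have "closedin K (C - G)" "closedin K (C - H)" "disjnt (C - G) (C - H)"
    using C G H by (auto simp: disjnt_def closedin_diff)
  ultimately obtain V W where V: "openin K V" "C - G \<subseteq> V" and W: "openin K W" "C - H \<subseteq> W"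
    and "disjnt V W"
    unfolding normal_space_def by metis
  then have "C = (C - V) \<union> (C - W)" by (auto simp: disjnt_def)
  then have "m C \<le> m (C - V) + m (C - W)"
    using C closedin_subset[OF C(1)] by (metis subadditive Diff_subset subset_trans)
  also have "\<dots> \<le> inner_content G + inner_content H"
    using C V W by (intro add_mono inner_upper closedin_diff) auto
  finally show "m C \<le> inner_content G + inner_content H" .
qed

text \<open>A closed set is compact, so finitely many of the \<open>G i\<close> already cover it. This is where
  countable subadditivity comes from.\<close>

lemma inner_UN:
  fixes G :: "nat \<Rightarrow> 'a set"
  assumes G: "\<And>i. openin K (G i)"
  shows "inner_content (\<Union>i. G i) \<le> (\<Sum>i. inner_content (G i))"
proof (rule inner_least)
  have finite_UN: "inner_content (\<Union>i<n. G i) \<le> (\<Sum>i<n. inner_content (G i))" for n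
  proof (induction n)
    case 0
    have "inner_content {} \<le> 0" by (rule inner_least) (auto simp: empty)
    then show ?case by simp
  next
    case (Suc n)
    have "inner_content (\<Union>i<Suc n. G i) \<le> inner_content (\<Union>i<n. G i) + inner_content (G n)"
      using inner_Un[of "\<Union>i<n. G i" "G n"] G by (auto simp: lessThan_Suc Un_commute)
    also have "\<dots> \<le> (\<Sum>i<Suc n. inner_content (G i))"
      using Suc by (simp add: add_right_mono)
    finally show ?case .
  qed
  fix C assume C: "closedin K C" "C \<subseteq> (\<Union>i. G i)"
  then have "compactin K C"
    using compact closedin_compact_space by blast
  then obtain \<F> where "finite \<F>" "\<F> \<subseteq> range G" "C \<subseteq> \<Union>\<F>"
    using C G unfolding compactin_def by (metis (no_types, lifting) rangeE)
  then obtain I where I: "finite I" "C \<subseteq> (\<Union>i\<in>I. G i)"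
    by (metis finite_subset_image)
  then obtain n where "I \<subseteq> {..<n}"
    using finite_nat_bounded by blast
  with I have "C \<subseteq> (\<Union>i<n. G i)" by blast
  then have "m C \<le> inner_content (\<Union>i<n. G i)"
    using C by (intro inner_upper)
  also note finite_UN
  also have "(\<Sum>i<n. inner_content (G i)) \<le> (\<Sum>i. inner_content (G i))"
    by (rule sum_le_suminf) auto
  finally show "m C \<le> (\<Sum>i. inner_content (G i))" .
qed

lemma outer_measure_space_outer_content: "outer_measure_space (Pow (topspace K)) outer_content"
  unfolding outer_measure_space_def
proof (intro conjI)
  have "inner_content {} \<le> 0" by (rule inner_least) (auto simp: empty)
  then show "positive (Pow (topspace K)) outer_content"
    by (simp add: positive_def outer_open)
  show "increasing (Pow (topspace K)) outer_content"
    by (auto simp: increasing_def outer_mono)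
  have "outer_content (\<Union>i. A i) \<le> (\<Sum>i. outer_content (A i))" for A :: "nat \<Rightarrow> 'a set"
  proof (rule ennreal_le_epsilon)
    fix e :: real assume e: "0 < e" and fin: "(\<Sum>i. outer_content (A i)) < top"
    have "\<exists>G. openin K G \<and> A i \<subseteq> G \<and> inner_content G < outer_content (A i) + e * (1/2)^Suc i" for i
    proof -
      have "outer_content (A i) < outer_content (A i) + e * (1/2)^Suc i"
        using e fin by (auto simp add: less_top dest!: ennreal_suminf_lessD)
      then show ?thesis
        by (subst (asm) (1) outer_content_def) (auto simp: INF_less_iff)
    qed
    then obtain G where G: "\<And>i. openin K (G i)" "\<And>i. A i \<subseteq> G i"
      and less: "\<And>i. inner_content (G i) < outer_content (A i) + e * (1/2)^Suc i"
      by metis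
    have "outer_content (\<Union>i. A i) \<le> inner_content (\<Union>i. G i)"
      using G by (intro outer_lower) auto
    also have "\<dots> \<le> (\<Sum>i. inner_content (G i))"
      using G by (intro inner_UN)
    also have "\<dots> \<le> (\<Sum>i. outer_content (A i) + e * (1/2)^Suc i)"
      using less by (intro suminf_le) (auto intro: less_imp_le)
    also have "\<dots> = (\<Sum>i. outer_content (A i)) + (\<Sum>i. ennreal e * ennreal ((1/2) ^ Suc i))"
      using e by (subst suminf_add[symmetric])
                 (auto simp del: ennreal_suminf_cmult simp add: ennreal_mult[symmetric])
    also have "\<dots> = (\<Sum>i. outer_content (A i)) + e"
      unfolding ennreal_suminf_cmult
      by (subst suminf_ennreal_eq[OF zero_le_power power_half_series]) auto
    finally show "outer_content (\<Union>i. A i) \<le> (\<Sum>i. outer_content (A i)) + e" .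
  qed
  then show "countably_subadditive (Pow (topspace K)) outer_content"
    by (simp add: countably_subadditive_def)
qed

text \<open>For an open \<open>H\<close>, a closed \<open>C \<subseteq> H \<inter> G\<close> and a closed \<open>D \<subseteq> H - C\<close> are disjoint
  closed subsets of \<open>H\<close>, so \<open>m C + m D \<le> inner_content H\<close>. The supremum over \<open>D\<close> bounds
  the content of \<open>H - C\<close>, hence that of \<open>H - G\<close>; the supremum over \<open>C\<close> then gives the
  splitting of \<open>H\<close>.\<close>

lemma open_Caratheodory:
  assumes G: "openin K G"
  shows "G \<in> lambda_system (topspace K) (Pow (topspace K)) outer_content"
proof -
  interpret algebra "topspace K" "Pow (topspace K)" by (rule algebra_Pow)
  have split_open: "outer_content (H \<inter> G) + outer_content (H - G) \<le> inner_content H" if H: "openin K H" for H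
  proof -
    have "m C + outer_content (H - G) \<le> inner_content H" if C: "closedin K C" "C \<subseteq> H \<inter> G" for C
    proof -
      have "m C + outer_content (H - G) \<le> m C + inner_content (H - C)"
        using C H by (intro add_left_mono outer_lower) auto
      also have "\<dots> = (SUP D\<in>{D. closedin K D \<and> D \<subseteq> H - C}. m C + m D)"
        unfolding inner_content_def by (intro ennreal_SUP_add_right) auto
      also have "\<dots> \<le> inner_content H"
      proof (safe intro!: SUP_least)
        fix D assume D: "closedin K D" "D \<subseteq> H - C"
        then have "m C + m D = m (C \<union> D)"
          using C closedin_subset by (intro additive[symmetric]) auto
        also have "\<dots> \<le> inner_content H"
          using C D by (intro inner_upper) auto
        finally show "m C + m D \<le> inner_content H" .
      qed
      finally show ?thesis .
    qed
    then have "(SUP C\<in>{C. closedin K C \<and> C \<subseteq> H \<inter> G}. m C + outer_content (H - G)) \<le> inner_content H"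
      by (auto intro!: SUP_least)
    moreover have "(SUP C\<in>{C. closedin K C \<and> C \<subseteq> H \<inter> G}. m C + outer_content (H - G))
        = inner_content (H \<inter> G) + outer_content (H - G)"
      unfolding inner_content_def by (intro ennreal_SUP_add_left) auto
    ultimately show ?thesis
      using G H by (simp add: outer_open openin_Int)
  qed
  have "outer_content (A \<inter> G) + outer_content (A - G) = outer_content A" if A: "A \<subseteq> topspace K" for A
  proof (rule antisym)
    show "outer_content (A \<inter> G) + outer_content (A - G) \<le> outer_content A"
    proof (rule outer_greatest)
      fix H assume H: "openin K H" "A \<subseteq> H"
      then have "outer_content (A \<inter> G) + outer_content (A - G) \<le> outer_content (H \<inter> G) + outer_content (H - G)"
        by (intro add_mono outer_mono) auto
      with split_open[OF H(1)] show "outer_content (A \<inter> G) + outer_content (A - G) \<le> inner_content H"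
        by (rule order_trans[rotated])
    qed
    have "subadditive (Pow (topspace K)) outer_content"
      using outer_measure_space_outer_content
      by (auto simp: outer_measure_space_def intro: countably_subadditive_subadditive)
    then have "outer_content ((A \<inter> G) \<union> (A - G)) \<le> outer_content (A \<inter> G) + outer_content (A - G)"
      using A by (intro subadditiveD) auto
    then show "outer_content A \<le> outer_content (A \<inter> G) + outer_content (A - G)"
      by (simp add: Int_Diff_Un)
  qed
  then show ?thesis
    using openin_subset[OF G] by (auto simp: lambda_system_eq)
qed

text \<open>Outer regularity is built into the outer content; inner regularity is outer regularity of the
  complement, because complements of open sets are compact.\<close>

theorem regular_measure_above_on_closed_sets:
  obtains \<mu> where "regular_probability_measure K \<mu>" "\<And>C. closedin K C \<Longrightarrow> m C \<le> emeasure \<mu> C"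
proof -
  define \<mu> where "\<mu> = measure_of (topspace K) (sigma_sets (topspace K) {S. openin K S}) outer_content"
  have opens: "{S. openin K S} \<subseteq> Pow (topspace K)"
    using openin_subset by auto
  have space: "space \<mu> = topspace K"
    and sets: "sets \<mu> = sigma_sets (topspace K) {S. openin K S}"
    using sigma_sets_into_sp[OF opens] sigma_sets_sigma_sets_eq[OF opens]
    by (auto simp: \<mu>_def space_measure_of_conv sets_measure_of_conv)
  have L: "measure_space (topspace K) (lambda_system (topspace K) (Pow (topspace K)) outer_content) outer_content"
    using sigma_algebra.caratheodory_lemma[OF sigma_algebra_Pow outer_measure_space_outer_content] .
  then interpret L: sigma_algebra "topspace K" "lambda_system (topspace K) (Pow (topspace K)) outer_content"
    by (simp add: measure_space_def)
  have sub: "sigma_sets (topspace K) {S. openin K S} \<subseteq> lambda_system (topspace K) (Pow (topspace K)) outer_content"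
    by (intro L.sigma_sets_subset) (auto intro: open_Caratheodory)
  have "measure_space (topspace K) (sigma_sets (topspace K) {S. openin K S}) outer_content"
    unfolding measure_space_def countably_additive_def
  proof (intro conjI allI impI)
    fix A :: "nat \<Rightarrow> 'a set"
    assume A: "range A \<subseteq> sigma_sets (topspace K) {S. openin K S}" "disjoint_family A"
      "\<Union> (range A) \<in> sigma_sets (topspace K) {S. openin K S}"
    from A(1,3) sub have "range A \<subseteq> lambda_system (topspace K) (Pow (topspace K)) outer_content"
      "\<Union> (range A) \<in> lambda_system (topspace K) (Pow (topspace K)) outer_content"
      by (blast dest: subsetD)+
    with A(2) L show "(\<Sum>i. outer_content (A i)) = outer_content (\<Union> (range A))"
      unfolding measure_space_def countably_additive_def by blast
  qed (use L opens in \<open>auto simp: measure_space_def positive_def sigma_algebra_sigma_sets\<close>)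
  then have emeasure: "emeasure \<mu> A = outer_content A" if "A \<in> sets \<mu>" for A
    using that unfolding \<mu>_def sets[unfolded \<mu>_def]
    by (intro emeasure_measure_of_sigma) (auto simp: measure_space_def)
  have open_sets: "G \<in> sets \<mu>" if "openin K G" for G
    using that by (auto simp: sets)
  have closed_sets: "C \<in> sets \<mu>" if "closedin K C" for C
  proof -
    have "topspace K - (topspace K - C) \<in> sets \<mu>"
      using that by (metis open_sets openin_diff openin_topspace sets.compl_sets space)
    then show ?thesis
      using closedin_subset[OF that] by (simp add: double_diff)
  qed
  have above: "m C \<le> emeasure \<mu> C" if "closedin K C" for C
    using that by (simp add: emeasure closed_sets closed_le_outer)
  have "inner_content (topspace K) = 1"
    using inner_upper[of "topspace K" "topspace K"] mono
    by (intro antisym inner_least) (auto simp: total closedin_subset simp flip: total)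
  then interpret \<mu>: prob_space \<mu>
    by (intro prob_spaceI) (simp add: space emeasure open_sets outer_open)
  have outer_regular: "emeasure \<mu> A = (INF G\<in>{G. openin K G \<and> A \<subseteq> G}. emeasure \<mu> G)"
    if "A \<in> sets \<mu>" for A
  proof -
    have "emeasure \<mu> A = (INF G\<in>{G. openin K G \<and> A \<subseteq> G}. inner_content G)"
      using that by (simp add: emeasure outer_content_def)
    also have "\<dots> = (INF G\<in>{G. openin K G \<and> A \<subseteq> G}. emeasure \<mu> G)"
      by (intro INF_cong refl) (auto simp: emeasure open_sets outer_open)
    finally show ?thesis .
  qed
  have inner_regular: "emeasure \<mu> A = (SUP C\<in>{C. compactin K C \<and> C \<subseteq> A}. emeasure \<mu> C)"
    if A: "A \<in> sets \<mu>" for A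
  proof (rule antisym)
    have A_sub: "A \<subseteq> topspace K"
      using sets.sets_into_space[OF A] by (simp add: space)
    show "emeasure \<mu> A \<le> (SUP C\<in>{C. compactin K C \<and> C \<subseteq> A}. emeasure \<mu> C)"
    proof (rule ennreal_le_epsilon)
      fix e :: real assume e: "e > 0"
      have compl: "topspace K - A \<in> sets \<mu>"
        using sets.compl_sets[OF A] by (simp add: space)
      have "emeasure \<mu> (topspace K - A) < emeasure \<mu> (topspace K - A) + e"
        using e \<mu>.emeasure_finite[of "topspace K - A"] by (auto simp: less_top)
      then obtain G where G: "openin K G" "topspace K - A \<subseteq> G"
        and less: "emeasure \<mu> G < emeasure \<mu> (topspace K - A) + e"
        by (subst (asm) (1) outer_regular[OF compl]) (auto simp: INF_less_iff)
      define C where "C = topspace K - G"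
      have C: "closedin K C" "C \<subseteq> A"
        using G by (auto simp: C_def)
      have "A - C \<subseteq> G - (topspace K - A)"
        using A_sub by (auto simp: C_def)
      then have "emeasure \<mu> (A - C) \<le> emeasure \<mu> (G - (topspace K - A))"
        using open_sets[OF G(1)] compl by (intro emeasure_mono sets.Diff[of G \<mu> "topspace K - A"])
      also have "\<dots> = emeasure \<mu> G - emeasure \<mu> (topspace K - A)"
        using G(2) open_sets[OF G(1)] compl by (intro emeasure_Diff) auto
      also have "\<dots> \<le> e"
        using less by (simp add: ennreal_minus_le_iff less_imp_le)
      finally have "emeasure \<mu> (A - C) \<le> e" .
      moreover have "emeasure \<mu> A = emeasure \<mu> C + emeasure \<mu> (A - C)"
        using C A closed_sets[OF C(1)] plus_emeasure[of C \<mu> "A - C"] by (simp add: Un_absorb1 sets.Diff)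
      ultimately have "emeasure \<mu> A \<le> emeasure \<mu> C + e"
        by (simp add: add_left_mono)
      also have "emeasure \<mu> C \<le> (SUP C\<in>{C. compactin K C \<and> C \<subseteq> A}. emeasure \<mu> C)"
        using C compact by (intro SUP_upper) (auto simp: closedin_compact_space)
      finally show "emeasure \<mu> A \<le> (SUP C\<in>{C. compactin K C \<and> C \<subseteq> A}. emeasure \<mu> C) + e"
        by (simp add: add_right_mono)
    qed
  qed (use A in \<open>auto intro!: SUP_least emeasure_mono\<close>)
  have "regular_probability_measure K \<mu>"
    unfolding regular_probability_measure_def
    using \<mu>.prob_space_axioms space sets inner_regular outer_regular by blast
  with above that show ?thesis by blast
qed

end

section \<open>Representing functionals by regular measures\<close>

lemma continuous_map_compact_bounded:
  fixes h :: "'a \<Rightarrow> real"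
  assumes "compact_space K" "continuous_map K euclidean h"
  shows "bounded (h ` topspace K)"
proof -
  have "compactin euclidean (h ` topspace K)"
    using assms by (intro image_compactin[of K]) (auto simp: compact_space_def)
  then show ?thesis by (simp add: compact_imp_bounded)
qed

lemma closed_in_sets_regular:
  assumes "regular_probability_measure K \<mu>" and "closedin K C"
  shows "C \<in> sets \<mu>"
proof -
  have "topspace K - (topspace K - C) \<in> sets \<mu>"
    using assms sets.compl_sets[of "topspace K - C" \<mu>]
    by (auto simp: regular_probability_measure_def closedin_def)
  then show ?thesis
    using closedin_subset[OF assms(2)] by (simp add: double_diff)
qed

lemma continuous_map_measurable_regular:
  assumes "regular_probability_measure K \<mu>" and "continuous_map K euclidean h"
  shows "h \<in> borel_measurable \<mu>"
proof (rule borel_measurableI)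
  fix S :: "'b set" assume "open S"
  then have "openin K {x \<in> topspace K. h x \<in> S}"
    using openin_continuous_map_preimage[OF assms(2)] by auto
  moreover have "h -` S \<inter> space \<mu> = {x \<in> topspace K. h x \<in> S}"
    using assms(1) by (auto simp: regular_probability_measure_def)
  ultimately show "h -` S \<inter> space \<mu> \<in> sets \<mu>"
    using assms(1) by (auto simp: regular_probability_measure_def)
qed

lemma continuous_map_integrable_regular:
  fixes h :: "'a \<Rightarrow> real"
  assumes K: "compact_space K" and \<mu>: "regular_probability_measure K \<mu>"
    and h: "continuous_map K euclidean h"
  shows "integrable \<mu> h"
proof -
  interpret prob_space \<mu> using \<mu> by (simp add: regular_probability_measure_def)
  obtain B where "\<And>x. x \<in> topspace K \<Longrightarrow> \<bar>h x\<bar> \<le> B"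
    using continuous_map_compact_bounded[OF K h] by (auto simp: bounded_iff)
  then show ?thesis
    using \<mu> continuous_map_measurable_regular[OF \<mu> h]
    by (intro integrable_const_bound[of _ B]) (auto simp: regular_probability_measure_def)
qed

text \<open>The sum is \<open>t\<close> rounded down to a multiple of \<open>\<epsilon>\<close>.\<close>

lemma step_function_approximation:
  fixes t \<epsilon> :: real
  assumes t: "0 \<le> t" "t \<le> real n * \<epsilon>" and \<epsilon>: "\<epsilon> > 0"
  shows "(\<Sum>k<n. \<epsilon> * of_bool (real (Suc k) * \<epsilon> \<le> t)) \<le> t"
    and "t \<le> (\<Sum>k<n. \<epsilon> * of_bool (real (Suc k) * \<epsilon> \<le> t)) + \<epsilon>"
proof -
  define j where "j = nat \<lfloor>t / \<epsilon>\<rfloor>"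
  have "real j \<le> t / \<epsilon>" "t / \<epsilon> < real j + 1"
    using t \<epsilon> by (simp_all add: j_def)
  then have j: "real j * \<epsilon> \<le> t" "t < (real j + 1) * \<epsilon>"
    using \<epsilon> by (simp_all only: pos_le_divide_eq pos_divide_less_eq)
  then have "real j * \<epsilon> \<le> real n * \<epsilon>" using t by linarith
  then have "j \<le> n" using \<epsilon> by simp
  have "real (Suc k) * \<epsilon> \<le> t \<longleftrightarrow> k < j" for k
  proof
    assume "real (Suc k) * \<epsilon> \<le> t"
    then have "real (Suc k) * \<epsilon> < (real j + 1) * \<epsilon>" using j by linarith
    then show "k < j" using \<epsilon> by simp
  next
    assume "k < j"
    then have "real (Suc k) * \<epsilon> \<le> real j * \<epsilon>" using \<epsilon> by (intro mult_right_mono) auto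
    then show "real (Suc k) * \<epsilon> \<le> t" using j by linarith
  qed
  then have "(\<Sum>k<n. \<epsilon> * of_bool (real (Suc k) * \<epsilon> \<le> t)) = (\<Sum>k<n. \<epsilon> * of_bool (k < j))"
    by simp
  also have "\<dots> = (\<Sum>k<j. \<epsilon>)"
    using \<open>j \<le> n\<close> by (intro sum.mono_neutral_cong_right) auto
  finally have "(\<Sum>k<n. \<epsilon> * of_bool (real (Suc k) * \<epsilon> \<le> t)) = real j * \<epsilon>" by simp
  with j show "(\<Sum>k<n. \<epsilon> * of_bool (real (Suc k) * \<epsilon> \<le> t)) \<le> t"
    and "t \<le> (\<Sum>k<n. \<epsilon> * of_bool (real (Suc k) * \<epsilon> \<le> t)) + \<epsilon>"
    by (simp_all add: algebra_simps)
qed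

text \<open>A positive normalized functional on all bounded functions is a finitely additive probability on
  indicators. The regular measure \<open>\<mu>\<close> built from it dominates it on closed sets. A nonnegative
  continuous \<open>h\<close> is, up to \<open>\<epsilon>\<close>, a positive combination of indicators of its closed
  superlevel sets, so \<open>\<Lambda> h \<le> (\<integral>x. h x \<partial>\<mu>)\<close>. Adding a constant removes the sign
  condition, and the inequality for \<open>- h\<close> is the converse one.\<close>

theorem Riesz_representation_compact_Hausdorff:
  fixes K :: "'a topology" and \<Lambda> :: "('a \<Rightarrow> real) \<Rightarrow> real"
  assumes compact: "compact_space K" and Hausdorff: "Hausdorff_space K"
    and add: "\<And>f g. bounded (f ` topspace K) \<Longrightarrow> bounded (g ` topspace K) \<Longrightarrow>
          \<Lambda> (\<lambda>x. f x + g x) = \<Lambda> f + \<Lambda> g"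
    and scale: "\<And>c f. bounded (f ` topspace K) \<Longrightarrow> \<Lambda> (\<lambda>x. c * f x) = c * \<Lambda> f"
    and upper: "\<And>f b. bounded (f ` topspace K) \<Longrightarrow> (\<And>x. x \<in> topspace K \<Longrightarrow> f x \<le> b) \<Longrightarrow> \<Lambda> f \<le> b"
  obtains \<mu> where "regular_probability_measure K \<mu>"
    and "\<And>h. continuous_map K euclidean h \<Longrightarrow> (\<integral>x. h x \<partial>\<mu>) = \<Lambda> h"
proof -
  have bdd_add: "bounded ((\<lambda>x. f x + g x) ` topspace K)"
    if "bounded (f ` topspace K)" "bounded (g ` topspace K)" for f g :: "'a \<Rightarrow> real"
    using that by (rule bounded_plus_comp)
  have bdd_scale: "bounded ((\<lambda>x. c * f x) ` topspace K)"
    if "bounded (f ` topspace K)" for c and f :: "'a \<Rightarrow> real"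
    using bounded_scaling[OF that, of c] by (simp add: image_image)
  have bdd_indicator: "bounded ((indicator A :: 'a \<Rightarrow> real) ` topspace K)" for A
    by (rule boundedI[of _ 1]) (auto simp: indicator_def)
  have bdd_const: "bounded ((\<lambda>_. c :: real) ` topspace K)" for c
    by (rule boundedI[of _ "\<bar>c\<bar>"]) auto
  have \<Lambda>_mono: "\<Lambda> f \<le> \<Lambda> g"
    if "bounded (f ` topspace K)" "bounded (g ` topspace K)" "\<And>x. x \<in> topspace K \<Longrightarrow> f x \<le> g x" for f g
    using upper[of "\<lambda>x. f x + (- 1) * g x" 0] that bdd_scale[of g "- 1"] bdd_add[of f "\<lambda>x. (- 1) * g x"]
      add[of f "\<lambda>x. (- 1) * g x"] scale[of g "- 1"] by simp
  have \<Lambda>_const: "\<Lambda> (\<lambda>_. c) = c" for c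
    using upper[of "\<lambda>_. c" c] upper[of "\<lambda>_. - c" "- c"] scale[of "\<lambda>_. c" "- 1"] bdd_const by simp
  have \<Lambda>_sum: "\<Lambda> (\<lambda>x. \<Sum>k<n. c * indicator (A k) x) = (\<Sum>k<n. c * \<Lambda> (indicator (A k)))
      \<and> bounded ((\<lambda>x. \<Sum>k<n. c * indicator (A k) x) ` topspace K)" for n c and A :: "nat \<Rightarrow> 'a set"
  proof (induction n)
    case (Suc n)
    then show ?case
      using add[of "\<lambda>x. \<Sum>k<n. c * indicator (A k) x" "\<lambda>x. c * indicator (A n) x"]
        bdd_add[of "\<lambda>x. \<Sum>k<n. c * indicator (A k) x" "\<lambda>x. c * indicator (A n) x"]
      by (simp add: scale bdd_scale bdd_indicator)
  qed (use \<Lambda>_const[of 0] bdd_const[of 0] in simp)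
  define m where "m A = ennreal (\<Lambda> (indicator A))" for A
  have \<Lambda>_nonneg: "0 \<le> \<Lambda> (indicator A)" for A
    using \<Lambda>_mono[OF bdd_const bdd_indicator, of 0 A] by (simp add: \<Lambda>_const)
  interpret finitely_additive_probability K m
  proof
    show "m {} = 0"
      using \<Lambda>_const[of 0] by (simp add: m_def indicator_def[abs_def])
    show "m (A \<union> B) = m A + m B" if "A \<inter> B = {}" for A B
    proof -
      have "(indicator (A \<union> B) :: 'a \<Rightarrow> real) = (\<lambda>x. indicator A x + indicator B x)"
        using that by (intro ext) (auto simp: indicator_def)
      then show ?thesis
        by (simp add: m_def add bdd_indicator \<Lambda>_nonneg)
    qed
    have "\<Lambda> (indicator (topspace K)) = 1"
      using \<Lambda>_mono[OF bdd_const bdd_indicator, of 1] \<Lambda>_mono[OF bdd_indicator bdd_const, of _ 1]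
      by (intro antisym) (auto simp: \<Lambda>_const)
    then show "m (topspace K) = 1"
      by (simp add: m_def)
  qed (use compact Hausdorff in auto)
  obtain \<mu> where \<mu>: "regular_probability_measure K \<mu>"
    and above: "\<And>C. closedin K C \<Longrightarrow> m C \<le> emeasure \<mu> C"
    using regular_measure_above_on_closed_sets by blast
  interpret \<mu>: prob_space \<mu> using \<mu> by (simp add: regular_probability_measure_def)
  have space: "space \<mu> = topspace K" using \<mu> by (simp add: regular_probability_measure_def)
  have above': "\<Lambda> (indicator C) \<le> measure \<mu> C" if "closedin K C" for C
    using above[OF that] \<Lambda>_nonneg by (simp add: m_def \<mu>.emeasure_eq_measure)
  have integrable: "integrable \<mu> h" if "continuous_map K euclidean h" for h :: "'a \<Rightarrow> real"
    using continuous_map_integrable_regular[OF compact \<mu> that] .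
  have nonneg: "\<Lambda> h \<le> (\<integral>x. h x \<partial>\<mu>)"
    if h: "continuous_map K euclidean h" and pos: "\<And>x. x \<in> topspace K \<Longrightarrow> 0 \<le> h x" for h
  proof (rule field_le_epsilon)
    fix \<epsilon> :: real assume \<epsilon>: "\<epsilon> > 0"
    have bdd_h: "bounded (h ` topspace K)"
      using continuous_map_compact_bounded[OF compact h] .
    then obtain B where B: "\<And>x. x \<in> topspace K \<Longrightarrow> h x \<le> B"
      by (auto simp: bounded_iff abs_le_iff)
    obtain n where n: "B / \<epsilon> \<le> real n" using real_arch_simple by blast
    then have n: "B \<le> real n * \<epsilon>" using \<epsilon> by (simp add: field_simps)
    define C where "C k = {x \<in> topspace K. real (Suc k) * \<epsilon> \<le> h x}" for k
    have C: "closedin K (C k)" for k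
      using closedin_continuous_map_preimage[OF h, of "{real (Suc k) * \<epsilon>..}"] by (simp add: C_def)
    have C_sets: "C k \<in> sets \<mu>" for k
      by (rule closed_in_sets_regular[OF \<mu> C])
    then have int_C: "integrable \<mu> (indicator (C k) :: 'a \<Rightarrow> real)" for k
      by (simp add: integrable_indicator_iff \<mu>.emeasure_eq_measure)
    define s where "s x = (\<Sum>k<n. \<epsilon> * indicator (C k) x)" for x
    have s: "s x \<le> h x" "h x \<le> s x + \<epsilon>" if "x \<in> topspace K" for x
    proof -
      have "s x = (\<Sum>k<n. \<epsilon> * of_bool (real (Suc k) * \<epsilon> \<le> h x))"
        using that by (simp add: s_def C_def indicator_def)
      moreover have "0 \<le> h x" "h x \<le> real n * \<epsilon>"
        using pos[OF that] B[OF that] n by auto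
      ultimately show "s x \<le> h x" "h x \<le> s x + \<epsilon>"
        using step_function_approximation[of "h x" n \<epsilon>] \<epsilon> by simp_all
    qed
    have \<Lambda>s: "\<Lambda> s = (\<Sum>k<n. \<epsilon> * \<Lambda> (indicator (C k)))" and bdd_s: "bounded (s ` topspace K)"
      unfolding s_def using \<Lambda>_sum[where n = n and c = \<epsilon> and A = C] by auto
    have "\<Lambda> h \<le> \<Lambda> (\<lambda>x. s x + \<epsilon>)"
      using s bdd_s bdd_h by (intro \<Lambda>_mono bdd_add bdd_const) auto
    also have "\<dots> = \<Lambda> s + \<epsilon>"
      using bdd_s by (simp add: add bdd_const \<Lambda>_const)
    also have "\<Lambda> s \<le> (\<Sum>k<n. \<epsilon> * measure \<mu> (C k))"
      unfolding \<Lambda>s using \<epsilon> C by (intro sum_mono mult_left_mono above') auto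
    also have "\<dots> = (\<integral>x. s x \<partial>\<mu>)"
      unfolding s_def using C_sets int_C sets.sets_into_space[OF C_sets]
      by (subst Bochner_Integration.integral_sum) (auto simp: Int_absorb2)
    also have "(\<integral>x. s x \<partial>\<mu>) \<le> (\<integral>x. h x \<partial>\<mu>)"
    proof (rule integral_mono)
      show "integrable \<mu> s"
        unfolding s_def by (intro Bochner_Integration.integrable_sum integrable_mult_right int_C)
    qed (use s integrable[OF h] in \<open>auto simp: space\<close>)
    finally show "\<Lambda> h \<le> (\<integral>x. h x \<partial>\<mu>) + \<epsilon>" by simp
  qed
  have le: "\<Lambda> h \<le> (\<integral>x. h x \<partial>\<mu>)" if h: "continuous_map K euclidean h" for h
  proof -
    have bdd_h: "bounded (h ` topspace K)"
      using continuous_map_compact_bounded[OF compact h] .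
    then obtain B where B: "\<And>x. x \<in> topspace K \<Longrightarrow> - h x \<le> B"
      by (auto simp: bounded_iff abs_le_iff)
    have "0 \<le> h x + B" if "x \<in> topspace K" for x
      using B[OF that] by simp
    then have "\<Lambda> (\<lambda>x. h x + B) \<le> (\<integral>x. h x + B \<partial>\<mu>)"
      using h by (intro nonneg continuous_map_add) auto
    then show ?thesis
      using integrable[OF h] bdd_h by (simp add: add bdd_const \<Lambda>_const \<mu>.prob_space)
  qed
  have "(\<integral>x. h x \<partial>\<mu>) = \<Lambda> h" if h: "continuous_map K euclidean h" for h
  proof (rule antisym[OF _ le[OF h]])
    have "continuous_map K euclidean (\<lambda>x. - 1 * h x)"
      using h by (intro continuous_map_real_mult) auto
    from le[OF this] show "(\<integral>x. h x \<partial>\<mu>) \<le> \<Lambda> h"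
      using scale[of h "- 1"] continuous_map_compact_bounded[OF compact h] by simp
  qed
  with \<mu> that show ?thesis by blast
qed

text \<open>A minimax principle: the Hahn--Banach theorem separates the cone from the strictly positive
  functions by a positive functional, which on continuous functions is integration.\<close>

theorem regular_measure_nonpositive_on_cone:
  fixes K :: "'a topology" and F :: "('a \<Rightarrow> real) set"
  assumes compact: "compact_space K" and Hausdorff: "Hausdorff_space K"
    and cont: "\<And>f. f \<in> F \<Longrightarrow> continuous_map K euclidean f"
    and zero: "(\<lambda>_. 0) \<in> F"
    and add: "\<And>f g. f \<in> F \<Longrightarrow> g \<in> F \<Longrightarrow> (\<lambda>x. f x + g x) \<in> F"
    and scale: "\<And>c f. c > 0 \<Longrightarrow> f \<in> F \<Longrightarrow> (\<lambda>x. c * f x) \<in> F"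
    and small: "\<And>f \<epsilon>. f \<in> F \<Longrightarrow> \<epsilon> > 0 \<Longrightarrow> \<exists>x\<in>topspace K. f x < \<epsilon>"
  obtains \<mu> where "regular_probability_measure K \<mu>" and "\<And>f. f \<in> F \<Longrightarrow> (\<integral>x. f x \<partial>\<mu>) \<le> 0"
proof (rule positive_functional_nonpositive_on_cone[of F "topspace K"])
  show "bounded (f ` topspace K)" if "f \<in> F" for f
    using continuous_map_compact_bounded[OF compact cont[OF that]] .
next
  fix \<Lambda> :: "('a \<Rightarrow> real) \<Rightarrow> real"
  assume \<Lambda>: "\<And>f g. bounded (f ` topspace K) \<Longrightarrow> bounded (g ` topspace K) \<Longrightarrow>
          \<Lambda> (\<lambda>x. f x + g x) = \<Lambda> f + \<Lambda> g"
       "\<And>c f. bounded (f ` topspace K) \<Longrightarrow> \<Lambda> (\<lambda>x. c * f x) = c * \<Lambda> f"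
       "\<And>f b. bounded (f ` topspace K) \<Longrightarrow> (\<And>x. x \<in> topspace K \<Longrightarrow> f x \<le> b) \<Longrightarrow> \<Lambda> f \<le> b"
    and nonpos: "\<And>f. f \<in> F \<Longrightarrow> \<Lambda> f \<le> 0"
  show thesis
  proof (rule Riesz_representation_compact_Hausdorff[OF compact Hausdorff, of \<Lambda>])
    fix \<mu> assume "regular_probability_measure K \<mu>"
      and "\<And>h. continuous_map K euclidean h \<Longrightarrow> (\<integral>x. h x \<partial>\<mu>) = \<Lambda> h"
    with cont nonpos show thesis by (intro that) auto
  qed (fact \<Lambda>)+
qed (use zero add scale small in blast)+

section \<open>Compactness of polars\<close>

lemma compact_scalar_ball: "compact (cball (0 :: 'k::real_or_complex) r)"
proof -
  consider "\<forall>z::'k. \<exists>a. z = a *\<^sub>R 1"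
    | j :: 'k where "\<forall>z. \<exists>a b. z = a *\<^sub>R 1 + b *\<^sub>R j \<and> norm z = sqrt (a\<^sup>2 + b\<^sup>2)"
    using real_or_complex by blast
  \<comment> \<open>in both cases the ball is the image under a continuous map of a ball in the plane; the real
    case uses only one coordinate\<close>
  then obtain f :: "real \<times> real \<Rightarrow> 'k" where f: "continuous_on UNIV f" and
    image: "\<And>z. \<exists>w. z = f w \<and> norm w = norm z"
  proof cases
    case 1
    have "\<exists>w::real \<times> real. z = fst w *\<^sub>R 1 \<and> norm w = norm z" for z :: 'k
    proof -
      obtain a where "z = a *\<^sub>R 1" using 1 by blast
      then show ?thesis by (intro exI[of _ "(a, 0)"]) (simp add: norm_Pair)
    qed
    then show ?thesis
      by (intro that[of "\<lambda>w. fst w *\<^sub>R 1"] continuous_intros)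
  next
    case (2 j)
    have "\<exists>w::real \<times> real. z = fst w *\<^sub>R 1 + snd w *\<^sub>R j \<and> norm w = norm z" for z :: 'k
    proof -
      obtain a b where "z = a *\<^sub>R 1 + b *\<^sub>R j" "norm z = sqrt (a\<^sup>2 + b\<^sup>2)" using 2 by blast
      then show ?thesis by (intro exI[of _ "(a, b)"]) (simp add: norm_Pair)
    qed
    then show ?thesis
      by (intro that[of "\<lambda>w. fst w *\<^sub>R 1 + snd w *\<^sub>R j"] continuous_intros)
  qed
  have "compact (f ` cball 0 r)"
    using f by (intro compact_continuous_image continuous_on_subset[OF f]) auto
  moreover have "cball 0 r \<subseteq> f ` cball 0 r"
  proof
    fix z :: 'k assume z: "z \<in> cball 0 r"
    obtain w where "z = f w" "norm w = norm z" using image by blast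
    with z show "z \<in> f ` cball 0 r" by auto
  qed
  ultimately show ?thesis
    using compact_Int_closed[of "f ` cball 0 r" "cball 0 r"] by (simp add: Int_absorb1)
qed

context locally_convex_space
begin

lemma continuous_map_scaled_translate: "continuous_map X X (\<lambda>y. smul c (y + z))"
proof -
  have "continuous_map X (prod_topology X X) (\<lambda>y. (y, z))"
    by (intro continuous_map_pairedI) (auto simp: topspace_UNIV)
  from continuous_map_compose[OF this continuous_add]
  have "continuous_map X X (\<lambda>y. y + z)" by (simp add: o_def)
  then have "continuous_map X (prod_topology euclidean X) (\<lambda>y. (c, y + z))"
    by (intro continuous_map_pairedI) auto
  from continuous_map_compose[OF this continuous_scale] show ?thesis
    by (simp add: o_def)
qed

text \<open>The filter form lets one scalar be chosen for finitely many points at once.\<close>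

lemma zero_nhd_absorbing:
  assumes "zero_nhd X U"
  shows "\<forall>\<^sub>F c in at_right 0. smul (of_real c) x \<in> U"
proof -
  obtain W where W: "openin X W" "0 \<in> W" "W \<subseteq> U"
    using assms by (auto simp: zero_nhd_def)
  have "continuous_map euclidean (prod_topology euclidean X) (\<lambda>c. (c, x))"
    by (intro continuous_map_pairedI) (auto simp: topspace_UNIV)
  from continuous_map_compose[OF this continuous_scale]
  have "continuous_map euclidean X (\<lambda>c. smul c x)" by (simp add: o_def)
  from openin_continuous_map_preimage[OF this W(1)]
  have "open {c. smul c x \<in> W}" by simp
  moreover have "0 \<in> {c. smul c x \<in> W}" using W by simp
  ultimately obtain \<delta> where "\<delta> > 0" "ball 0 \<delta> \<subseteq> {c. smul c x \<in> W}"
    unfolding open_contains_ball by blast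
  then have \<delta>: "\<delta> > 0" "\<And>c. norm c < \<delta> \<Longrightarrow> smul c x \<in> W"
    by (auto simp: subset_iff)
  then have "smul (of_real c) x \<in> U" if "0 < c" "c < \<delta>" for c
    using that W by (intro subsetD[OF W(3)] \<delta>(2)) simp
  then show ?thesis
    using \<delta>(1) by (auto simp: eventually_at_right_field)
qed

lemma linear_bounded_on_nhd_continuous:
  assumes \<phi>: "Vector_Spaces.linear smul (*) \<phi>"
    and U: "zero_nhd X U" "\<And>x. x \<in> U \<Longrightarrow> norm (\<phi> x) \<le> 1"
  shows "continuous_map X euclidean \<phi>"
proof -
  obtain W where W: "openin X W" "0 \<in> W" "W \<subseteq> U"
    using U(1) by (auto simp: zero_nhd_def)
  have add: "\<phi> (x + y) = \<phi> x + \<phi> y" and scale: "\<phi> (smul c x) = c * \<phi> x" for x y c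
    using \<phi> by (auto simp: Vector_Spaces.linear_iff)
  have diff: "\<phi> (y - x) = \<phi> y - \<phi> x" for x y
    using add[of "y - x" x] by simp
  have "openin X {x \<in> topspace X. \<phi> x \<in> S}" if "open S" for S
  proof (subst openin_subopen, intro ballI)
    fix x assume "x \<in> {x \<in> topspace X. \<phi> x \<in> S}"
    then obtain e where e: "e > 0" "ball (\<phi> x) e \<subseteq> S"
      using \<open>open S\<close> by (auto simp: open_contains_ball)
    define N where "N = {y \<in> topspace X. smul (of_real (2 / e)) (y + - x) \<in> W}"
    have "\<phi> y \<in> S" if "y \<in> N" for y
    proof -
      have "norm (\<phi> (smul (of_real (2 / e)) (y + - x))) \<le> 1"
        using that W U(2) by (auto simp: N_def)
      then have "norm (of_real (2 / e) * (\<phi> y - \<phi> x)) \<le> 1"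
        by (simp only: scale diff add_uminus_conv_diff)
      then have "(2 / e) * norm (\<phi> y - \<phi> x) \<le> 1"
        using e unfolding norm_mult norm_of_real by simp
      then have "norm (\<phi> y - \<phi> x) < e"
        using e by (simp add: field_simps)
      then show ?thesis
        using e(2) by (auto simp: dist_norm norm_minus_commute)
    qed
    moreover have "openin X N"
      unfolding N_def by (rule openin_continuous_map_preimage[OF continuous_map_scaled_translate W(1)])
    moreover have "x \<in> N"
      using W by (simp add: N_def topspace_UNIV)
    ultimately show "\<exists>N. openin X N \<and> x \<in> N \<and> N \<subseteq> {x \<in> topspace X. \<phi> x \<in> S}"
      by (intro exI[of _ N]) (auto simp: topspace_UNIV)
  qed
  then show ?thesis
    by (auto simp: continuous_map_def)
qed

end

lemma vector_space_scalars: "vector_space ((*) :: 'k::field \<Rightarrow> 'k \<Rightarrow> 'k)"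
  by unfold_locales (auto simp: algebra_simps)

text \<open>A linear functional that is bounded on \<open>U\<close> is continuous for \<open>M\<close>, and \<open>M\<close> and \<open>X\<close>
  have the same dual. Membership in the polar therefore amounts to conditions on finitely many values each, and
  such closed conditions survive pointwise limits.\<close>

lemma polar_set_mackey_nhd:
  assumes M: "locally_convex_space smul M" and dual: "dual_space smul M = dual_space smul X"
    and U: "zero_nhd M U"
  shows "polar_set smul X U = {\<phi>. (\<forall>x y. \<phi> (x + y) = \<phi> x + \<phi> y) \<and> (\<forall>c x. \<phi> (smul c x) = c * \<phi> x)
    \<and> (\<forall>x\<in>U. norm (\<phi> x) \<le> 1)}"
proof -
  interpret M: locally_convex_space smul M by (rule M)
  have "\<phi> \<in> dual_space smul M \<longleftrightarrow> (\<forall>x y. \<phi> (x + y) = \<phi> x + \<phi> y) \<and> (\<forall>c x. \<phi> (smul c x) = c * \<phi> x)"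
    if "\<forall>x\<in>U. norm (\<phi> x) \<le> 1" for \<phi>
    using that M.linear_bounded_on_nhd_continuous[OF _ U, of \<phi>]
    by (auto simp: dual_space_def operator_def Vector_Spaces.linear_iff M.vector_space_axioms vector_space_scalars)
  then show ?thesis
    unfolding polar_set_def dual[symmetric] by blast
qed

lemma continuous_map_evaluation:
  "continuous_map (product_topology (\<lambda>_. euclidean) UNIV) euclidean (\<lambda>\<phi>. \<phi> x)"
  by (rule continuous_map_product_projection) auto

text \<open>If \<open>r x \<cdot> x \<in> U\<close>, then \<open>\<phi> x\<close> lies in the ball of radius \<open>1 / r x\<close> for every
  \<open>\<phi>\<close> in the polar. Hence the polar is a closed subset of a product of compact balls.\<close>

theorem Alaoglu_polar:
  fixes smul :: "'k::real_or_complex \<Rightarrow> 'e::ab_group_add \<Rightarrow> 'e"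
  assumes M: "locally_convex_space smul M" and dual: "dual_space smul M = dual_space smul X"
    and U: "zero_nhd M U"
  shows "compactin (product_topology (\<lambda>_. euclidean) UNIV) (polar_set smul X U)"
proof -
  interpret M: locally_convex_space smul M by (rule M)
  let ?P = "product_topology (\<lambda>_. euclidean) UNIV :: ('e \<Rightarrow> 'k) topology"
  note polar = polar_set_mackey_nhd[OF M dual U]
  have "\<exists>r>0. smul (of_real r) x \<in> U" for x
    using eventually_happens[OF eventually_conj[OF M.zero_nhd_absorbing[OF U, of x] eventually_at_right_less[of 0]]]
    by auto
  then obtain r where r: "\<And>x. r x > 0" "\<And>x. smul (of_real (r x)) x \<in> U" by metis
  have "compactin ?P (\<Pi>\<^sub>E x\<in>UNIV. cball 0 (1 / r x))"
    by (simp add: compactin_PiE compact_scalar_ball)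
  moreover have "polar_set smul X U \<subseteq> (\<Pi>\<^sub>E x\<in>UNIV. cball 0 (1 / r x))"
  proof
    fix \<phi> assume \<phi>: "\<phi> \<in> polar_set smul X U"
    have "norm (\<phi> x) \<le> 1 / r x" for x
    proof -
      have "norm (\<phi> (smul (of_real (r x)) x)) \<le> 1"
        using \<phi> r(2) by (auto simp: polar_set_def)
      moreover have "\<phi> (smul (of_real (r x)) x) = of_real (r x) * \<phi> x"
        using \<phi> by (simp add: polar)
      ultimately show ?thesis
        using r(1)[of x] by (simp add: norm_mult field_simps)
    qed
    then show "\<phi> \<in> (\<Pi>\<^sub>E x\<in>UNIV. cball 0 (1 / r x))" by auto
  qed
  moreover have "closedin ?P (polar_set smul X U)"
  proof -
    have ev: "continuous_map ?P euclidean (\<lambda>\<phi>. \<phi> x)" for x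
      by (rule continuous_map_evaluation)
    have eq: "closedin ?P {\<phi>. f \<phi> = (0::'k)}" if "continuous_map ?P euclidean f" for f
      using closedin_continuous_map_preimage[OF that, of "{0}"] by simp
    have "closedin ?P {\<phi>. \<phi> (x + y) - (\<phi> x + \<phi> y) = 0}" for x y
      by (intro eq continuous_map_diff continuous_map_add ev)
    moreover have "closedin ?P {\<phi>. \<phi> (smul c x) - c * \<phi> x = 0}" for c x
    proof -
      have "continuous_map ?P euclidean ((\<lambda>z. c * z) \<circ> (\<lambda>\<phi>. \<phi> x))"
        by (rule continuous_map_compose[OF ev]) (auto intro!: continuous_intros)
      then show ?thesis
        by (intro eq continuous_map_diff ev) (simp add: o_def)
    qed
    moreover have "closedin ?P {\<phi>. norm (\<phi> x) \<le> 1}" for x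
      using closedin_continuous_map_preimage[OF ev[of x], of "cball 0 1"] by simp
    moreover have "polar_set smul X U = (\<Inter>x. \<Inter>y. {\<phi>. \<phi> (x + y) - (\<phi> x + \<phi> y) = 0})
        \<inter> (\<Inter>c. \<Inter>x. {\<phi>. \<phi> (smul c x) - c * \<phi> x = 0}) \<inter> (\<Inter>x\<in>U. {\<phi>. norm (\<phi> x) \<le> 1})"
      by (auto simp: polar)
    moreover have "U \<noteq> {}"
      using U by (auto simp: zero_nhd_def)
    ultimately show ?thesis
      by (auto intro!: closedin_Int closedin_INT)
  qed
  ultimately show ?thesis by (rule closed_compactin)
qed

section \<open>Gauges\<close>

lemma gauge_fun_nonneg:
  assumes "\<exists>r>0. y \<in> smul (of_real r) ` V"
  shows "0 \<le> gauge_fun smul V y"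
  unfolding gauge_fun_def using assms by (intro cInf_greatest) auto

text \<open>Absorption guarantees that the infimum ranges over a nonempty set.\<close>

lemma gauge_fun_scale:
  assumes "vector_space smul" and nonempty: "\<And>y. \<exists>r>0. y \<in> smul (of_real r) ` V" and t: "t > 0"
  shows "gauge_fun smul V (smul (of_real t) y) = t * gauge_fun smul V y"
proof -
  interpret vector_space smul by fact
  have le: "gauge_fun smul V (smul (of_real t) y) \<le> t * gauge_fun smul V y" if t: "t > 0" for t y
  proof -
    have "gauge_fun smul V (smul (of_real t) y) / t \<le> gauge_fun smul V y"
      unfolding gauge_fun_def[of smul V y]
    proof (rule cInf_greatest)
      fix r assume r: "r \<in> {r. 0 < r \<and> y \<in> smul (of_real r) ` V}"
      then have "t * r \<in> {r. 0 < r \<and> smul (of_real t) y \<in> smul (of_real r) ` V}"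
        using t by auto
      then have "gauge_fun smul V (smul (of_real t) y) \<le> t * r"
        unfolding gauge_fun_def by (intro cInf_lower bdd_belowI[of _ 0]) auto
      then show "gauge_fun smul V (smul (of_real t) y) / t \<le> r"
        using t by (simp add: field_simps)
    qed (use nonempty[of y] in auto)
    then show ?thesis using t by (simp add: field_simps)
  qed
  have "gauge_fun smul V y \<le> (1 / t) * gauge_fun smul V (smul (of_real t) y)"
    using le[of "1 / t" "smul (of_real t) y"] t by simp
  then show ?thesis
    using le[OF t, of y] t by (simp add: field_simps)
qed

section \<open>Pietsch domination\<close>

text \<open>If the sum were at least \<open>\<delta>\<close> for all \<open>\<phi> \<in> P\<close>, then the supremum in the summing
  inequality would be too small by a definite amount. Lists make the families closed under
  concatenation, which is addition of the corresponding functions of \<open>\<phi>\<close>.\<close>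

lemma summing_estimate_attained_approximately:
  fixes q :: "'e \<Rightarrow> real" and xs :: "'e list" and P :: "('e \<Rightarrow> 'k::real_normed_field) set"
  assumes p: "0 < p" and C: "C > 0" and q: "\<And>x. 0 \<le> q x"
    and summing: "\<And>n (x :: nat \<Rightarrow> 'e). \<forall>i\<le>n. x i \<in> U \<Longrightarrow>
        (\<Sum>i\<le>n. q (x i) powr p) powr (1 / p)
          \<le> C * (SUP \<phi>\<in>P. (\<Sum>i\<le>n. norm (\<phi> (x i)) powr p) powr (1 / p))"
    and P: "P \<noteq> {}" and xs: "set xs \<subseteq> U" and \<delta>: "\<delta> > 0"
  shows "\<exists>\<phi>\<in>P. (\<Sum>x\<leftarrow>xs. q x powr p - C powr p * norm (\<phi> x) powr p) < \<delta>"
proof (cases "xs = []")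
  case True
  then show ?thesis using P \<delta> by auto
next
  case False
  define n where "n = length xs - 1"
  have sum_xs: "(\<Sum>x\<leftarrow>xs. f x) = (\<Sum>i\<le>n. f (xs ! i))" for f :: "'e \<Rightarrow> real"
  proof -
    have "(\<Sum>x\<leftarrow>xs. f x) = (\<Sum>i = 0..<length xs. f (xs ! i))"
      by (simp add: sum_list_sum_nth)
    also have "{0..<length xs} = {..n}"
      using False by (cases xs) (auto simp: n_def)
    finally show ?thesis .
  qed
  have U: "\<forall>i\<le>n. xs ! i \<in> U"
  proof (intro allI impI)
    fix i assume "i \<le> n"
    then have "i < length xs" using False by (cases xs) (auto simp: n_def)
    then show "xs ! i \<in> U" using xs by (meson nth_mem subsetD)
  qed
  define Q where "Q = (\<Sum>i\<le>n. q (xs ! i) powr p)"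
  define S where "S \<phi> = (\<Sum>i\<le>n. norm (\<phi> (xs ! i)) powr p)" for \<phi> :: "'e \<Rightarrow> 'k"
  have sum_eq: "(\<Sum>x\<leftarrow>xs. q x powr p - C powr p * norm (\<phi> x) powr p) = Q - C powr p * S \<phi>" for \<phi>
    by (simp add: sum_xs Q_def S_def sum_subtractf sum_distrib_left)
  have Q: "0 \<le> Q" and S: "0 \<le> S \<phi>" for \<phi>
    by (auto simp: Q_def S_def intro: sum_nonneg)
  show ?thesis
  proof (rule ccontr)
    assume "\<not> ?thesis"
    then have "C powr p * S \<phi> \<le> Q - \<delta>" if "\<phi> \<in> P" for \<phi>
      using that unfolding sum_eq by force
    then have S_le: "S \<phi> \<le> (Q - \<delta>) / C powr p" if "\<phi> \<in> P" for \<phi>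
      using that C by (simp add: field_simps)
    define R where "R = (Q - \<delta>) / C powr p"
    have R: "0 \<le> R"
      using P S_le S by (fastforce simp: R_def intro: order_trans)
    have "Q powr (1 / p) \<le> C * (SUP \<phi>\<in>P. S \<phi> powr (1 / p))"
      using summing[OF U] by (simp add: Q_def S_def)
    also have "(SUP \<phi>\<in>P. S \<phi> powr (1 / p)) \<le> R powr (1 / p)"
      using P S S_le p by (intro cSUP_least powr_mono2) (auto simp: R_def)
    finally have "Q powr (1 / p) \<le> C * R powr (1 / p)"
      using C by simp
    then have "(Q powr (1 / p)) powr p \<le> (C * R powr (1 / p)) powr p"
      using p by (intro powr_mono2) auto
    then have "Q \<le> C powr p * R"
      using p C Q R by (simp add: powr_mult powr_powr)
    then show False
      using C \<delta> by (simp add: R_def)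
  qed
qed

text \<open>This is the Pietsch argument, with \<open>q\<close> in the role of the gauge of \<open>T x\<close>, \<open>s t\<close> in the
  role of multiplication by \<open>t > 0\<close>, and \<open>K\<close> in the role of the polar of \<open>U\<close>. The
  constant is the same on both sides. For domination, the functions
  \<open>\<phi> \<mapsto> (\<Sum>x\<leftarrow>xs. q x powr p - C powr p * norm (\<phi> x) powr p)\<close> form a cone: lists are
  concatenated, and multiplication by \<open>c\<close> is scaling of the points by \<open>c powr (1 / p)\<close>. The
  summing inequality says that no such function is bounded away from \<open>0\<close> from below. Conversely,
  the domination inequality is summed and the integrand bounded by its supremum.\<close>

lemma summing_iff_dominated:
  fixes K :: "('e \<Rightarrow> 'k::real_normed_field) topology" and q :: "'e \<Rightarrow> real"
  assumes p: "0 < p" and C: "C > 0"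
    and compact: "compact_space K"
    and Hausdorff: "Hausdorff_space K"
    and evaluation: "\<And>x. continuous_map K euclidean (\<lambda>\<phi>. \<phi> x)"
    and nonempty: "topspace K \<noteq> {}"
    and polar: "\<And>\<phi> x. \<phi> \<in> topspace K \<Longrightarrow> x \<in> U \<Longrightarrow> norm (\<phi> x) \<le> 1"
    and q_nonneg: "\<And>x. 0 \<le> q x"
    and q_scale: "\<And>t x. t > 0 \<Longrightarrow> q (s t x) = t * q x"
    and scale: "\<And>\<phi> t x. \<phi> \<in> topspace K \<Longrightarrow> t > 0 \<Longrightarrow> norm (\<phi> (s t x)) = t * norm (\<phi> x)"
    and absorbing: "\<And>x. \<forall>\<^sub>F t in at_right (0::real). s t x \<in> U"
  shows "(\<forall>n. \<forall>x :: nat \<Rightarrow> 'e. (\<forall>i\<le>n. x i \<in> U) \<longrightarrow>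
        (\<Sum>i\<le>n. q (x i) powr p) powr (1 / p)
          \<le> C * (SUP \<phi>\<in>topspace K. (\<Sum>i\<le>n. norm (\<phi> (x i)) powr p) powr (1 / p)))
     \<longleftrightarrow> (\<exists>\<mu>. regular_probability_measure K \<mu> \<and>
           (\<forall>x. q x powr p \<le> C powr p * (\<integral>\<phi>. norm (\<phi> x) powr p \<partial>\<mu>)))"
    (is "?summing \<longleftrightarrow> ?dominated")
proof -
  have cont: "continuous_map K euclidean (\<lambda>\<phi>. norm (\<phi> x) powr p)" for x
  proof -
    have "continuous_map K euclidean ((\<lambda>z. norm z powr p) \<circ> (\<lambda>\<phi>. \<phi> x))"
    proof (rule continuous_map_compose[OF evaluation])
      have "continuous_on UNIV (\<lambda>z :: 'k. norm z powr p)"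
        using p by (intro continuous_on_powr' continuous_on_norm continuous_on_const continuous_on_id) auto
      then show "continuous_map euclidean euclidean (\<lambda>z :: 'k. norm z powr p)" by simp
    qed
    then show ?thesis by (simp add: o_def)
  qed
  show ?thesis
  proof
    assume summing: ?summing
    define f where "f xs \<phi> = (\<Sum>x\<leftarrow>xs. q x powr p - C powr p * norm (\<phi> x) powr p)"
      for xs and \<phi> :: "'e \<Rightarrow> 'k"
    have f_scale: "f (map (s t) xs) \<phi> = t powr p * f xs \<phi>" if "t > 0" "\<phi> \<in> topspace K" for t xs \<phi>
      using that by (induction xs)
        (simp_all add: f_def q_scale scale powr_mult q_nonneg algebra_simps)
    \<comment> \<open>\<open>scale\<close> speaks only about points of \<open>K\<close>, so the functions are cut off outside \<open>K\<close> to make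
      the cone closed under multiplication\<close>
    define G where "G xs \<phi> = (if \<phi> \<in> topspace K then f xs \<phi> else 0)" for xs \<phi>
    have f_cont: "continuous_map K euclidean (f xs)" for xs
      unfolding f_def
      by (induction xs) (auto intro!: continuous_map_add continuous_map_diff continuous_map_real_mult cont)
    obtain \<mu> where \<mu>: "regular_probability_measure K \<mu>"
      and nonpos: "\<And>g. g \<in> range G \<Longrightarrow> (\<integral>\<phi>. g \<phi> \<partial>\<mu>) \<le> 0"
    proof (rule regular_measure_nonpositive_on_cone[OF compact Hausdorff, of "range G"])
      show "continuous_map K euclidean g" if "g \<in> range G" for g
      proof -
        from that obtain xs where "g = G xs" by auto
        then show ?thesis
          by (intro continuous_map_eq[OF f_cont[of xs]]) (simp add: G_def)
      qed
      have "G [] = (\<lambda>_. 0)" by (auto simp: G_def f_def)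
      then show "(\<lambda>_. 0) \<in> range G" by (metis rangeI)
      show "(\<lambda>\<phi>. g \<phi> + h \<phi>) \<in> range G" if gh: "g \<in> range G" "h \<in> range G" for g h
      proof -
        from gh obtain xs ys where "g = G xs" "h = G ys" by auto
        then have "(\<lambda>\<phi>. g \<phi> + h \<phi>) = G (xs @ ys)" by (auto simp: G_def f_def)
        then show ?thesis by simp
      qed
      show "(\<lambda>\<phi>. c * g \<phi>) \<in> range G" if c: "c > 0" and g: "g \<in> range G" for c g
      proof -
        from g obtain xs where xs: "g = G xs" by auto
        have "c = (c powr (1 / p)) powr p" using c p by (simp add: powr_powr)
        then have "(\<lambda>\<phi>. c * g \<phi>) = G (map (s (c powr (1 / p))) xs)"
          using c by (auto simp: G_def xs f_scale)
        then show ?thesis by simp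
      qed
      show "\<exists>\<phi>\<in>topspace K. g \<phi> < \<epsilon>" if g: "g \<in> range G" and \<epsilon>: "\<epsilon> > 0" for g \<epsilon>
      proof -
        from g obtain xs where xs: "g = G xs" by auto
        \<comment> \<open>the summing inequality concerns points of \<open>U\<close> only, but scaling all points by the same
          \<open>t\<close> just multiplies the function by \<open>t powr p\<close>\<close>
        have "\<forall>\<^sub>F t in at_right (0::real). \<forall>x\<in>set xs. s t x \<in> U"
          using absorbing by (simp add: eventually_ball_finite)
        then obtain t :: real where t: "t > 0" "\<And>x. x \<in> set xs \<Longrightarrow> s t x \<in> U"
          using eventually_happens[OF eventually_conj[OF _ eventually_at_right_less[of 0]]] by force
        have "\<exists>\<phi>\<in>topspace K. (\<Sum>x\<leftarrow>map (s t) xs. q x powr p - C powr p * norm (\<phi> x) powr p) < t powr p * \<epsilon>"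
        proof (rule summing_estimate_attained_approximately[OF p C q_nonneg _ nonempty, of U])
          show "set (map (s t) xs) \<subseteq> U" using t by auto
          show "0 < t powr p * \<epsilon>" using t \<epsilon> by simp
        qed (use summing in blast)
        then obtain \<phi> where "\<phi> \<in> topspace K" "f (map (s t) xs) \<phi> < t powr p * \<epsilon>"
          unfolding f_def by blast
        then show ?thesis
          using t(1) by (auto simp: f_scale xs G_def)
      qed
    next
      fix \<mu> assume "regular_probability_measure K \<mu>" "\<And>g. g \<in> range G \<Longrightarrow> (\<integral>\<phi>. g \<phi> \<partial>\<mu>) \<le> 0"
      then show thesis by (rule that)
    qed
    interpret prob_space \<mu> using \<mu> by (simp add: regular_probability_measure_def)
    have space: "space \<mu> = topspace K" using \<mu> by (simp add: regular_probability_measure_def)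
    have "q x powr p \<le> C powr p * (\<integral>\<phi>. norm (\<phi> x) powr p \<partial>\<mu>)" for x
    proof -
      have "(\<integral>\<phi>. q x powr p - C powr p * norm (\<phi> x) powr p \<partial>\<mu>) = (\<integral>\<phi>. G [x] \<phi> \<partial>\<mu>)"
        by (intro Bochner_Integration.integral_cong) (auto simp: G_def f_def space)
      also have "\<dots> \<le> 0" by (intro nonpos) auto
      finally show ?thesis
        using continuous_map_integrable_regular[OF compact \<mu> cont[of x]] by (simp add: prob_space)
    qed
    with \<mu> show ?dominated by blast
  next
    assume ?dominated
    then obtain \<mu> where \<mu>: "regular_probability_measure K \<mu>"
      and dominated: "\<And>x. q x powr p \<le> C powr p * (\<integral>\<phi>. norm (\<phi> x) powr p \<partial>\<mu>)" by blast
    interpret prob_space \<mu> using \<mu> by (simp add: regular_probability_measure_def)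
    have space: "space \<mu> = topspace K" using \<mu> by (simp add: regular_probability_measure_def)
    show ?summing
    proof (intro allI impI)
      fix n and x :: "nat \<Rightarrow> 'e" assume x: "\<forall>i\<le>n. x i \<in> U"
      define S where "S \<phi> = (\<Sum>i\<le>n. norm (\<phi> (x i)) powr p)" for \<phi> :: "'e \<Rightarrow> 'k"
      define M where "M = (SUP \<phi>\<in>topspace K. S \<phi> powr (1 / p))"
      have S_nonneg: "0 \<le> S \<phi>" for \<phi> by (auto simp: S_def intro: sum_nonneg)
      have "S \<phi> \<le> real (Suc n)" if "\<phi> \<in> topspace K" for \<phi>
      proof -
        have "S \<phi> \<le> (\<Sum>i\<le>n. 1)"
          unfolding S_def using that x p by (intro sum_mono powr_le1) (auto intro: polar)
        then show ?thesis by simp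
      qed
      then have "bdd_above ((\<lambda>\<phi>. S \<phi> powr (1 / p)) ` topspace K)"
        using p S_nonneg by (intro bdd_aboveI2[of _ _ "real (Suc n) powr (1 / p)"] powr_mono2) auto
      then have S_M: "S \<phi> powr (1 / p) \<le> M" if "\<phi> \<in> topspace K" for \<phi>
        unfolding M_def using that by (intro cSUP_upper)
      then have M: "0 \<le> M"
        using nonempty by (metis all_not_in_conv order_trans powr_ge_zero)
      have S_le: "S \<phi> \<le> M powr p" if "\<phi> \<in> topspace K" for \<phi>
        using powr_mono2[of p "S \<phi> powr (1 / p)" M] S_M[OF that] p S_nonneg[of \<phi>] by (simp add: powr_powr)
      have int: "integrable \<mu> (\<lambda>\<phi>. norm (\<phi> (x i)) powr p)" for i
        by (rule continuous_map_integrable_regular[OF compact \<mu> cont])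
      have "(\<Sum>i\<le>n. q (x i) powr p) \<le> (\<Sum>i\<le>n. C powr p * (\<integral>\<phi>. norm (\<phi> (x i)) powr p \<partial>\<mu>))"
        by (intro sum_mono dominated)
      also have "\<dots> = C powr p * (\<integral>\<phi>. S \<phi> \<partial>\<mu>)"
        unfolding S_def using int by (simp add: sum_distrib_left)
      also have "(\<integral>\<phi>. S \<phi> \<partial>\<mu>) \<le> (\<integral>\<phi>. M powr p \<partial>\<mu>)"
        using int S_le by (intro integral_mono) (auto simp: S_def space)
      also have "\<dots> = M powr p" by (simp add: prob_space)
      finally have "(\<Sum>i\<le>n. q (x i) powr p) \<le> (C * M) powr p"
        using C M by (simp add: powr_mult)
      then have "(\<Sum>i\<le>n. q (x i) powr p) powr (1 / p) \<le> ((C * M) powr p) powr (1 / p)"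
        using p by (intro powr_mono2) (auto intro: sum_nonneg)
      also have "\<dots> = C * M" using p C M by (simp add: powr_powr)
      finally show "(\<Sum>i\<le>n. q (x i) powr p) powr (1 / p)
          \<le> C * (SUP \<phi>\<in>topspace K. (\<Sum>i\<le>n. norm (\<phi> (x i)) powr p) powr (1 / p))"
        by (simp add: M_def S_def)
    qed
  qed
qed

theorem theorem17p14:
  fixes p :: real
    and smulE :: "'k::real_or_complex \<Rightarrow> 'e::ab_group_add \<Rightarrow> 'e" and E E\<mu> :: "'e topology"
    and smulL :: "'k \<Rightarrow> 'l::ab_group_add \<Rightarrow> 'l" and L :: "'l topology"
    and T :: "'e \<Rightarrow> 'l" and U :: "'e set" and K :: "('e \<Rightarrow> 'k) topology"
  assumes "1 \<le> p"
    and "locally_convex_space smulE E"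
    and "locally_convex_space smulL L"
    and "operator smulE E smulL L T"
    and "mackey_topology smulE E E\<mu>"
    and "U \<in> closed_abs_convex_nhds smulE E\<mu>"
    and "K = subtopology (weak_star_topology smulE E) (polar_set smulE E U)"
  shows "U_p_summing smulE E smulL L U p T \<longleftrightarrow>
    (\<forall>V \<in> closed_abs_convex_nhds smulL L.
       \<exists>\<mu>V. regular_probability_measure K \<mu>V \<and>
       (\<exists>C>0. \<forall>x. gauge_fun smulL V (T x) powr p
                 \<le> C powr p * (\<integral>\<phi>. norm (\<phi> x) powr p \<partial>\<mu>V)))"
proof -
  have p: "0 < p" using assms(1) by simp
  interpret L: locally_convex_space smulL L by fact
  have M: "locally_convex_space smulE E\<mu>" and dual: "dual_space smulE E\<mu> = dual_space smulE E"
    using assms(5) by (auto simp: mackey_topology_def)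
  interpret M: locally_convex_space smulE E\<mu> by (rule M)
  have U: "zero_nhd E\<mu> U"
    using assms(6) by (simp add: closed_abs_convex_nhds_def)
  let ?P = "product_topology (\<lambda>_. euclidean) UNIV :: ('e \<Rightarrow> 'k) topology"
  note polar = polar_set_mackey_nhd[OF M dual U]
  have "polar_set smulE E U \<subseteq> dual_space smulE E"
    by (auto simp: polar_set_def)
  then have K: "K = subtopology ?P (polar_set smulE E U)"
    by (simp add: assms(7) weak_star_topology_def subtopology_subtopology Int_absorb1)
  have topspace: "topspace K = polar_set smulE E U"
    by (simp add: K)
  have compact: "compact_space K"
    unfolding K using Alaoglu_polar[OF M dual U] by (rule compact_space_subtopology)
  have Hausdorff: "Hausdorff_space K"
    unfolding K by (intro Hausdorff_space_subtopology) (simp add: Hausdorff_space_product_topology)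
  have evaluation: "continuous_map K euclidean (\<lambda>\<phi>. \<phi> x)" for x
    unfolding K by (intro continuous_map_from_subtopology continuous_map_evaluation)
  have "(\<lambda>_. 0) \<in> topspace K"
    by (simp add: topspace polar)
  then have nonempty: "topspace K \<noteq> {}" by blast
  have T: "T (smulE c x) = smulL c (T x)" for c x
    using assms(4) by (simp add: operator_def Vector_Spaces.linear_iff)
  have pietsch: "(\<exists>C>0. \<forall>n. \<forall>x :: nat \<Rightarrow> 'e. (\<forall>i\<le>n. x i \<in> U) \<longrightarrow>
        (\<Sum>i\<le>n. gauge_fun smulL V (T (x i)) powr p) powr (1 / p)
          \<le> C * (SUP \<phi>\<in>polar_set smulE E U. (\<Sum>i\<le>n. norm (\<phi> (x i)) powr p) powr (1 / p)))
     \<longleftrightarrow> (\<exists>\<mu>. regular_probability_measure K \<mu> \<and>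
       (\<exists>C>0. \<forall>x. gauge_fun smulL V (T x) powr p \<le> C powr p * (\<integral>\<phi>. norm (\<phi> x) powr p \<partial>\<mu>)))"
    if V: "V \<in> closed_abs_convex_nhds smulL L" for V
  proof -
    have "zero_nhd L V" using V by (simp add: closed_abs_convex_nhds_def)
    have absorb: "\<exists>r>0. y \<in> smulL (of_real r) ` V" for y
    proof -
      obtain c :: real where c: "c > 0" "smulL (of_real c) y \<in> V"
        using eventually_happens[OF eventually_conj[OF L.zero_nhd_absorbing[OF \<open>zero_nhd L V\<close>, of y]
            eventually_at_right_less[of 0]]] by auto
      then have "y = smulL (of_real (1 / c)) (smulL (of_real c) y)"
        by simp
      with c show ?thesis by (intro exI[of _ "1 / c"]) (metis divide_pos_pos image_eqI zero_less_one)
    qed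
    have fixed_constant: "(\<forall>n. \<forall>x :: nat \<Rightarrow> 'e. (\<forall>i\<le>n. x i \<in> U) \<longrightarrow>
        (\<Sum>i\<le>n. gauge_fun smulL V (T (x i)) powr p) powr (1 / p)
          \<le> C * (SUP \<phi>\<in>polar_set smulE E U. (\<Sum>i\<le>n. norm (\<phi> (x i)) powr p) powr (1 / p)))
     \<longleftrightarrow> (\<exists>\<mu>. regular_probability_measure K \<mu> \<and>
           (\<forall>x. gauge_fun smulL V (T x) powr p \<le> C powr p * (\<integral>\<phi>. norm (\<phi> x) powr p \<partial>\<mu>)))"
      if C: "C > 0" for C
      unfolding topspace[symmetric]
    proof (rule summing_iff_dominated[OF p C compact Hausdorff evaluation nonempty,
          where s = "\<lambda>t. smulE (of_real t)"])
      show "gauge_fun smulL V (T (smulE (of_real t) x)) = t * gauge_fun smulL V (T x)" if "t > 0" for t x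
        unfolding T using gauge_fun_scale[OF L.vector_space_axioms absorb that] .
      show "0 \<le> gauge_fun smulL V (T x)" for x
        by (rule gauge_fun_nonneg[OF absorb])
      show "\<forall>\<^sub>F t in at_right 0. smulE (of_real t) x \<in> U" for x
        by (rule M.zero_nhd_absorbing[OF U])
      show "norm (\<phi> x) \<le> 1" if "\<phi> \<in> topspace K" "x \<in> U" for \<phi> x
        using that by (simp add: topspace polar_set_def)
      show "norm (\<phi> (smulE (of_real t) x)) = t * norm (\<phi> x)" if "\<phi> \<in> topspace K" "t > 0" for \<phi> t x
        using that by (simp add: topspace polar norm_mult)
    qed
    \<comment> \<open>for each constant the two sides agree; it remains to exchange the quantifiers over constant and measure\<close>
    have swap: "(\<exists>C>0. \<exists>\<mu>. R \<mu> \<and> Q C \<mu>) \<longleftrightarrow> (\<exists>\<mu>. R \<mu> \<and> (\<exists>C>0. Q C \<mu>))"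
      for R :: "('e \<Rightarrow> 'k) measure \<Rightarrow> bool" and Q :: "real \<Rightarrow> ('e \<Rightarrow> 'k) measure \<Rightarrow> bool"
      by blast
    show ?thesis
      unfolding swap[symmetric] by (rule ex_cong1, rule conj_cong, rule refl, rule fixed_constant)
  qed
  show ?thesis
    unfolding U_p_summing_def by (rule ball_cong[OF refl pietsch])
qed

end
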